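(* Let $\lambda>0$ and $N$ a nonnegative integer. Define $p(\lambda,x)=-\frac{2}{\lambda}+\sum_{m=-\infty}^\infty e^{-\lambda|x+m|}$ on $\mathbb{R}/\mathbb{Z}$ and the trigonometric polynomial $$k(\lambda,N;x)=-\tfrac{2}{\lambda}+\tfrac{1}{2N+2}\sum_{n=-N}^N\widehat{K}\left(\tfrac{\lambda}{2N+2},\tfrac{n}{2N+2}\right)e(nx),$$ where for $\rho>0$, $\widehat K(\rho,t)=\int_{-\infty}^\infty K(\rho,x)e(-tx)\,\mathrm{d}x$ with $K(\rho, z) = \left(\frac{\cos \pi z}{\pi}\right)\sum_{n \in \mathbb{Z}} \frac{ (-1)^{n}\, e^{-\rho|n- \frac{1}{2}|}}{z - n + \frac{1}{2}}$. Then: (i) If $\widetilde{k}(x)$ is a trigonometric polynomial of degree at most $N$, then $$\int_{\mathbb{R}/\mathbb{Z}}|p(\lambda,x)-\widetilde{k}(x)|\,\mathrm{d}x\ge\tfrac{2}{\lambda}-\tfrac{2}{\lambda}\,\mathrm{sech}\left(\tfrac{\lambda}{4N+4}\right),$$ with equality if and only if $\widetilde{k}(x)=k(\lambda,N;x)$. (ii) For $x\in\mathbb{R}/\mathbb{Z}$, $\operatorname{sgn}(\cos\pi(2N+2)x)=\operatorname{sgn}\{p(\lambda,x)-k(\lambda,N;x)\}$.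
   Context: $e(x)=e^{2\pi ix}$. Integration over $\mathbb{R}/\mathbb{Z}$ is with respect to Haar measure of total mass $1$. A trigonometric polynomial of degree at most $N$ is a function $\sum_{n=-N}^N c_ne(nx)$. *)

theory Defs
  imports "HOL-Analysis.Analysis"
begin

definition e :: "real \<Rightarrow> complex" where
  "e x = exp (complex_of_real (2 * pi * x) * \<i>)"

definition sech :: "real \<Rightarrow> real" where
  "sech x = 1 / cosh x"

definition p_fun :: "real \<Rightarrow> real \<Rightarrow> real" where
  "p_fun lam x = - 2 / lam + (\<Sum>\<^sub>\<infinity> m::int. exp (- lam * \<bar>x + of_int m\<bar>))"

definition K_fun :: "real \<Rightarrow> real \<Rightarrow> real" where
  "K_fun rho z = (cos (pi * z) / pi) *
     (\<Sum>\<^sub>\<infinity> n::int. (-1) powi n * exp (- rho * \<bar>of_int n - 1/2\<bar>) / (z - of_int n + 1/2))"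

definition K_hat :: "real \<Rightarrow> real \<Rightarrow> complex" where
  "K_hat rho t = (LINT x|lborel. complex_of_real (K_fun rho x) * e (- t * x))"

definition k_fun :: "real \<Rightarrow> nat \<Rightarrow> real \<Rightarrow> complex" where
  "k_fun lam N x = complex_of_real (- 2 / lam) +
     (1 / (2 * of_nat N + 2)) *
     (\<Sum>n = - int N .. int N.
        K_hat (lam / (2 * real N + 2)) (of_int n / (2 * real N + 2)) * e (of_int n * x))"

definition trig_poly :: "nat \<Rightarrow> (real \<Rightarrow> complex) \<Rightarrow> bool" where
  "trig_poly N f \<longleftrightarrow> (\<exists>c :: int \<Rightarrow> complex.
      \<forall>x. f x = (\<Sum>n = - int N .. int N. c n * e (of_int n * x)))"

end

theory Submission
  imports Defs "HOL-Real_Asymp.Real_Asymp" "HOL-Probability.Sinc_Integral"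
begin

text \<open>
  With \<^term>\<open>M = N + 1\<close>, the polynomial \<^term>\<open>k_fun lam N\<close> interpolates the periodized exponential at the
  \<^term>\<open>2 * M\<close> zeros of \<open>cos (2 \<pi> M x)\<close> in a period. Since the square wave \<open>sgn (cos (2 \<pi> M x))\<close> is
  orthogonal to all trigonometric polynomials of degree at most \<open>N\<close>, the integral of \<open>p\<close> against it bounds
  every approximation error from below, and an error whose sign is that of the square wave attains the bound.
  Conversely, an extremal polynomial must agree with \<open>p\<close> at all \<open>2 N + 2\<close> sign changes, and that determines it.

  The sign of the error is read off on the real line. For \<open>y \<ge> 0\<close> put
  \<open>Q(\<rho>) = \<pi> (exp (- \<rho> y) - K(\<rho>, y)) / cos (\<pi> y)\<close>. Termwise differentiation in \<open>\<rho>\<close> yields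
  \<open>(exp (\<rho> y) Q)' = 2 exp (\<rho> y) D\<close> with \<open>D = (\<Sum>n. (-1)^n exp (- \<rho> a\<^sub>n) a\<^sub>n / (a\<^sub>n + y))\<close>,
  \<open>a\<^sub>n = n + 1/2\<close>, and in turn \<open>(exp (- \<rho> y) D)' = exp (- \<rho> y) s'\<close> with \<open>s = 1 / (2 cosh (\<rho> / 2))\<close>. So \<open>D\<close> is
  positive as it tends to 0 at infinity, and \<open>Q\<close> is positive as it tends to 0 at \<open>\<rho> = 0\<close>, where it
  reduces to the partial fraction expansion of the secant. Periodizing \<open>K\<close> turns each pole pair into a
  difference of cotangents, which times the cosine is a Dirichlet kernel; unfolding the Fourier
  integral then identifies the coefficients with the values of \<^term>\<open>K_hat\<close>.
\<close>

subsection \<open>Partial fractions of the cotangent and the secant\<close>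

text \<open>Logarithmic differentiation of Gamma(z) Gamma(1 - z) = pi / sin(pi z), done in the
  complex plane and read off at a real point.\<close>

lemma Digamma_reflection_real:
  fixes x :: real
  assumes "x \<notin> \<int>"
  shows "Digamma (1 - x) - Digamma x = pi * cot (pi * x)"
proof -
  define z where "z = complex_of_real x"
  have z: "z \<notin> \<int>" unfolding z_def using assms by simp
  have z1: "z \<notin> \<int>\<^sub>\<le>\<^sub>0" "1 - z \<notin> \<int>\<^sub>\<le>\<^sub>0"
    using z nonpos_Ints_Int Ints_diff[of 1 "1 - z"] by auto
  have s: "sin (of_real pi * z) \<noteq> 0"
    using z by (simp add: sin_eq_0 mult.commute) (metis Ints_of_int)
  have G: "Gamma z * Gamma (1 - z) = of_real pi / sin (of_real pi * z)" for z :: complex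
    by (rule Gamma_reflection_complex)
  have d1: "((\<lambda>z. Gamma z * Gamma (1 - z)) has_field_derivative
     Gamma z * Gamma (1 - z) * (Digamma z - Digamma (1 - z))) (at z)"
    using z1 by (auto intro!: derivative_eq_intros simp: algebra_simps)
  have d2: "((\<lambda>z. of_real pi / sin (of_real pi * z)) has_field_derivative
      - (of_real pi / sin (of_real pi * z)) * (of_real pi * cot (of_real pi * z))) (at z)"
    using s by (auto intro!: derivative_eq_intros simp: cot_def field_simps power2_eq_square)
  \<comment> \<open>Both derivatives belong to the same function, so they agree; the nonzero factor
    pi / sin(pi z) is cancelled afterwards.\<close>
  have "of_real pi / sin (of_real pi * z) * (Digamma z - Digamma (1 - z))
      = - (of_real pi / sin (of_real pi * z)) * (of_real pi * cot (of_real pi * z))"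
    using d1 d2 unfolding G by (rule DERIV_unique)
  hence "of_real pi / sin (of_real pi * z) * (Digamma (1 - z) - Digamma z)
      = of_real pi / sin (of_real pi * z) * (of_real pi * cot (of_real pi * z))"
    by (simp add: algebra_simps)
  hence "Digamma (1 - z) - Digamma z = of_real pi * cot (of_real pi * z)"
    using s by simp
  moreover have "Digamma (1 - z) - Digamma z = of_real (Digamma (1 - x) - Digamma x)"
    using assms Polygamma_of_real[of x 0, where 'a = complex] Polygamma_of_real[of "1 - x" 0, where 'a = complex]
    by (cases "x = 0 \<or> x = 1") (auto simp: z_def)
  moreover have "of_real pi * cot (of_real pi * z) = of_real (pi * cot (pi * x))"
    by (simp add: z_def cot_def cos_of_real sin_of_real flip: of_real_mult of_real_divide)
  ultimately show ?thesis by (metis of_real_eq_iff)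
qed

text \<open>The Digamma series at \<open>1 - x\<close> and at \<open>x\<close> are subtracted, and
  the Euler-Mascheroni constants cancel. The poles at -n and n + 1 share a term, which is the
  grouping produced later by the windows \<open>{- int k..<int k}\<close>.\<close>

lemma cot_sums:
  fixes x :: real
  assumes "x \<notin> \<int>"
  shows "(\<lambda>n. 1 / (x + real n) + 1 / (x - 1 - real n)) sums (pi * cot (pi * x))"
proof -
  have S: "(\<lambda>k. inverse (real (Suc k)) - inverse (z + real k)) sums (Digamma z + euler_mascheroni)"
    if "z \<noteq> 0" for z :: real
    using summable_sums[OF summable_Digamma[OF that]] by (simp add: Digamma_def)
  have "x \<noteq> 0" "1 - x \<noteq> 0" using assms by auto
  from sums_diff[OF S[OF this(2)] S[OF this(1)]]
  have "(\<lambda>k. inverse (x + real k) - inverse (1 - x + real k)) sums (pi * cot (pi * x))"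
    using Digamma_reflection_real[OF assms] by (simp add: algebra_simps)
  moreover have "inverse (x + real k) - inverse (1 - x + real k) =
      1 / (x + real k) + 1 / (x - 1 - real k)" for k
  proof -
    have "x - 1 - real k = - (1 - x + real k)" by simp
    thus ?thesis by (metis diff_conv_add_uminus divide_minus_right inverse_eq_divide)
  qed
  ultimately show ?thesis by simp
qed

section \<open>Half-integers and the secant\<close>

definition half :: "nat \<Rightarrow> real" where "half n = real n + 1/2"

lemma half_pos [simp]: "half n > 0" "half n \<noteq> 0" by (auto simp: half_def add_pos_pos intro: less_imp_neq[symmetric])

lemma cos_half_eq_0: "cos (pi * (half n)) = 0"
  by (simp add: half_def algebra_simps cos_add)

lemma half_neq:
  assumes "cos (pi * y) \<noteq> 0"
  shows "y \<noteq> half n" "y \<noteq> - half n" "(half n)\<^sup>2 - y\<^sup>2 \<noteq> 0" "half n - y \<noteq> 0" "half n + y \<noteq> 0" "y + half n \<noteq> 0"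
proof -
  show 1: "y \<noteq> half n" "y \<noteq> - half n" using assms cos_half_eq_0[of n] by auto
  have "(half n)\<^sup>2 - y\<^sup>2 = (half n - y) * (half n + y)" by (simp add: power2_eq_square algebra_simps)
  thus "(half n)\<^sup>2 - y\<^sup>2 \<noteq> 0" "half n - y \<noteq> 0" "half n + y \<noteq> 0" "y + half n \<noteq> 0" using 1 by auto
qed

text \<open>Half of cot(pi w) + tan(pi w) equals 1 / sin(2 pi w), so the cotangent series at w and
  at 1/2 - w add up to the secant. Two consecutive pole pairs of opposite sign form one term; the
  limit at \<open>r = 0\<close> relies on the same grouping.\<close>

lemma sec_sums:
  fixes y :: real
  assumes "cos (pi * y) \<noteq> 0"
  shows "(\<lambda>n. 2 * half (2*n) / ((half (2*n))\<^sup>2 - y\<^sup>2) - 2 * half (2*n+1) / ((half (2*n+1))\<^sup>2 - y\<^sup>2))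
     sums (pi / cos (pi * y))"
proof -
  \<comment> \<open>Chosen so that 2 pi w = pi y + pi / 2; the integer and half-integer values of w
    then correspond to the half-integer values of y.\<close>
  define w where "w = (2 * y + 1) / 4"
  have cw: "cos (pi * y) = sin (2 * (pi * w))"
  proof -
    have "2 * (pi * w) = pi * y + pi / 2" by (simp add: w_def field_simps)
    thus ?thesis by (simp add: sin_add)
  qed
  have c: "sin (pi * w) \<noteq> 0" "cos (pi * w) \<noteq> 0"
    using assms unfolding cw sin_double by auto
  have w: "w \<notin> \<int>" using c(1) by (auto elim!: Ints_cases simp: sin_zero_iff_int2 mult.commute)
  have sw: "sin (pi * (1/2 - w)) = cos (pi * w)" "cos (pi * (1/2 - w)) = sin (pi * w)"
    by (simp_all add: right_diff_distrib sin_diff cos_diff)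
  have w': "1/2 - w \<notin> \<int>"
    using c(2) unfolding sw(1)[symmetric] by (auto elim!: Ints_cases simp: sin_zero_iff_int2 mult.commute)
  from sums_mult[OF sums_add[OF cot_sums[OF w] cot_sums[OF w']], of "1/2"]
  have "(\<lambda>n. 1/2 * (1 / (w + real n) + 1 / (w - 1 - real n) +
      (1 / (1/2 - w + real n) + 1 / (1/2 - w - 1 - real n))))
     sums (1/2 * (pi * cot (pi * w) + pi * cot (pi * (1/2 - w))))" .
  also have "1/2 * (pi * cot (pi * w) + pi * cot (pi * (1/2 - w))) = pi / cos (pi * y)"
  proof -
    have "pi * (cos (pi * w) * cos (pi * w)) + pi * (sin (pi * w) * sin (pi * w)) = pi"
      unfolding distrib_left[symmetric] using sin_cos_squared_add2[of "pi * w"]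
      by (simp add: power2_eq_square)
    thus ?thesis
      unfolding cw sin_double cot_def sw using c by (simp add: field_simps)
  qed
  also have "(\<lambda>n. 1/2 * (1 / (w + real n) + 1 / (w - 1 - real n) +
      (1 / (1/2 - w + real n) + 1 / (1/2 - w - 1 - real n)))) =
    (\<lambda>n. 2 * half (2*n) / ((half (2*n))\<^sup>2 - y\<^sup>2) - 2 * half (2*n+1) / ((half (2*n+1))\<^sup>2 - y\<^sup>2))"
  proof
    fix n
    define a b where "a = half (2*n)" and "b = half (2*n+1)"
    have nz: "a - y \<noteq> 0" "a + y \<noteq> 0" "b - y \<noteq> 0" "b + y \<noteq> 0"
      unfolding a_def b_def by (rule half_neq[OF assms])+
    have e: "w + real n = (a + y) / 2" "w - 1 - real n = - (b - y) / 2"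
        "1/2 - w + real n = (a - y) / 2" "1/2 - w - 1 - real n = - (b + y) / 2"
      by (simp_all add: a_def b_def half_def w_def field_simps)
    have f: "2 * c / (c\<^sup>2 - y\<^sup>2) = 1 / (c + y) + 1 / (c - y)" if "c - y \<noteq> 0" "c + y \<noteq> 0" for c
    proof -
      have "c\<^sup>2 - y\<^sup>2 = (c - y) * (c + y)" by (simp add: power2_eq_square algebra_simps)
      thus ?thesis using that by (simp add: field_simps)
    qed
    have g: "1 / (t / 2) = 2 * (1 / t)" "1 / (- t / 2) = - (2 * (1 / t))" for t :: real
      by (cases "t = 0"; simp add: field_simps)+
    have ring: "1/2 * (2 * p + 2 * - q + (2 * r + 2 * - t)) = p + r - (t + q)" for p q r t :: real
      by (simp add: algebra_simps)
    show "1/2 * (1 / (w + real n) + 1 / (w - 1 - real n) +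
      (1 / (1/2 - w + real n) + 1 / (1/2 - w - 1 - real n))) = 2 * half (2*n) / ((half (2*n))\<^sup>2 - y\<^sup>2) - 2 * half (2*n+1) / ((half (2*n+1))\<^sup>2 - y\<^sup>2)"
      unfolding e g divide_minus_right a_def[symmetric] b_def[symmetric] f[OF nz(1,2)] f[OF nz(3,4)]
      by (rule ring)
  qed
  finally show ?thesis .
qed

subsection \<open>Positivity of the interpolation error on the line\<close>

text \<open>The common shape of the series in \<open>r\<close>: differentiation multiplies the
  coefficients by \<open>- half n\<close>, so differential relations between such series become
  identities between coefficients.\<close>

definition alt_dirichlet :: "(nat \<Rightarrow> real) \<Rightarrow> real \<Rightarrow> real" where
  "alt_dirichlet b r = (\<Sum>n. (-1) ^ n * b n * exp (- r * half n))"

lemma half_ge_0 [simp]: "half n \<ge> 0" by (simp add: half_def)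

text \<open>Quadratic weights cover all later cases: \<open>K_majorant\<close> grows quadratically,
  and coefficients of linear growth pick up one factor \<open>half n\<close> under
  differentiation.\<close>

lemma summable_half_exp:
  assumes "r > 0"
  shows "summable (\<lambda>n. half n ^ 2 * exp (- r * half n))"
proof (rule summable_comparison_test_bigo)
  show "summable (\<lambda>n. norm (inverse (real n ^ 2)))"
    using inverse_power_summable[of 2, where 'a = real] by simp
  show "(\<lambda>n. half n ^ 2 * exp (- r * half n)) \<in> O(\<lambda>n. inverse (real n ^ 2))"
    unfolding half_def using assms by real_asymp
qed

lemma half_bigoE:
  assumes "b \<in> O(\<lambda>n. half n ^ k)"
  obtains C where "C \<ge> 0" "\<And>n. \<bar>b n\<bar> \<le> C * half n ^ k"
proof -
  from landau_o.bigE[OF assms] obtain c where c: "c > 0" "\<forall>\<^sub>F n in at_top. norm (b n) \<le> c * norm (half n ^ k)"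
    by blast
  from c(2) obtain N where N: "\<And>n. n \<ge> N \<Longrightarrow> norm (b n) \<le> c * norm (half n ^ k)"
    by (auto simp: eventually_at_top_linorder)
  \<comment> \<open>The finitely many terms outside the asymptotic bound are absorbed into the
    constant, which is possible because \<open>half n\<close> never vanishes.\<close>
  define C where "C = c + (\<Sum>n<N. \<bar>b n\<bar> / half n ^ k)"
  have sn: "(\<Sum>n<N. \<bar>b n\<bar> / half n ^ k) \<ge> 0" by (intro sum_nonneg) auto
  show ?thesis
  proof (rule that[of C])
    show "C \<ge> 0" using c(1) sn by (simp add: C_def)
    fix n
    show "\<bar>b n\<bar> \<le> C * half n ^ k"
    proof (cases "n < N")
      case True
      have "\<bar>b n\<bar> / half n ^ k \<le> (\<Sum>n<N. \<bar>b n\<bar> / half n ^ k)"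
        by (rule member_le_sum) (use True in auto)
      hence "\<bar>b n\<bar> / half n ^ k \<le> C" using c(1) by (simp add: C_def)
      thus ?thesis by (simp add: pos_divide_le_eq)
    next
      case False
      have "\<bar>b n\<bar> \<le> c * half n ^ k" using N[of n] False by simp
      also have "\<dots> \<le> C * half n ^ k" using sn by (intro mult_right_mono) (auto simp: C_def)
      finally show ?thesis .
    qed
  qed
qed

lemma alt_dirichlet_summable_norm:
  assumes "b \<in> O(\<lambda>n. half n ^ 2)" "r > 0"
  shows "summable (\<lambda>n. \<bar>b n\<bar> * exp (- r * half n))"
proof -
  obtain C where C: "C \<ge> 0" "\<And>n. \<bar>b n\<bar> \<le> C * half n ^ 2"
    using half_bigoE[OF assms(1)] by blast
  show ?thesis
  proof (rule summable_comparison_test')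
    show "summable (\<lambda>n. C * (half n ^ 2 * exp (- r * half n)))"
      by (intro summable_mult summable_half_exp assms)
    show "norm (\<bar>b n\<bar> * exp (- r * half n)) \<le> C * (half n ^ 2 * exp (- r * half n))" for n
      using C(2)[of n] by (simp add: abs_mult mult.assoc[symmetric] mult_right_mono)
  qed
qed

lemma alt_dirichlet_summable:
  assumes "b \<in> O(\<lambda>n. half n ^ 2)" "r > 0"
  shows "summable (\<lambda>n. (-1) ^ n * b n * exp (- r * half n))"
  by (rule summable_norm_cancel) (use alt_dirichlet_summable_norm[OF assms] in \<open>simp add: abs_mult\<close>)

lemma alt_dirichlet_lincomb:
  assumes "b \<in> O(\<lambda>n. half n ^ 2)" "c \<in> O(\<lambda>n. half n ^ 2)" "r > 0"
  shows "alt_dirichlet (\<lambda>n. u * b n + v * c n) r = u * alt_dirichlet b r + v * alt_dirichlet c r"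
proof -
  have "(\<lambda>n. u * ((-1) ^ n * b n * exp (- r * half n)) + v * ((-1) ^ n * c n * exp (- r * half n)))
    sums (u * alt_dirichlet b r + v * alt_dirichlet c r)"
    unfolding alt_dirichlet_def using alt_dirichlet_summable[OF assms(1,3)] alt_dirichlet_summable[OF assms(2,3)]
    by (intro sums_add sums_mult summable_sums)
  hence "(\<lambda>n. (-1) ^ n * (u * b n + v * c n) * exp (- r * half n)) sums (u * alt_dirichlet b r + v * alt_dirichlet c r)"
    by (simp add: algebra_simps)
  thus ?thesis unfolding alt_dirichlet_def by (simp add: sums_iff)
qed

lemma alt_dirichlet_deriv:
  assumes "b \<in> O(\<lambda>n. half n)" "r > 0"
  shows "(alt_dirichlet b has_real_derivative - alt_dirichlet (\<lambda>n. half n * b n) r) (at r)"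
proof -
  have b1: "b \<in> O(\<lambda>n. half n ^ 1)" using assms(1) by simp
  obtain C where C: "C \<ge> 0" "\<And>n. \<bar>b n\<bar> \<le> C * half n"
    using half_bigoE[OF b1] by (auto simp: power_one_right)
  have b2: "b \<in> O(\<lambda>n. half n ^ 2)"
  proof (rule landau_o.big_trans[OF assms(1)])
    show "half \<in> O(\<lambda>n. half n ^ 2)" unfolding half_def by real_asymp
  qed
  have b3: "(\<lambda>n. half n * b n) \<in> O(\<lambda>n. half n ^ 2)"
    unfolding power2_eq_square using assms(1) by (intro landau_o.big.mult) auto
  \<comment> \<open>Staying above \<open>r/2\<close> gives the differentiated series a single
    summable majorant on a neighbourhood of \<open>r\<close>.\<close>
  define S where "S = {r/2..}"
  have conv: "uniformly_convergent_on S (\<lambda>n x. \<Sum>i<n. - ((-1) ^ i * (half i * b i) * exp (- x * half i)))"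
  proof (rule Weierstrass_m_test')
    show "summable (\<lambda>n. C * (half n ^ 2 * exp (- (r/2) * half n)))"
      by (intro summable_mult summable_half_exp) (use assms in auto)
    fix n x assume x: "x \<in> S"
    have "norm (- ((-1) ^ n * (half n * b n) * exp (- x * half n))) = half n * \<bar>b n\<bar> * exp (- x * half n)"
      by (simp add: abs_mult abs_of_pos)
    also have "\<dots> \<le> half n * (C * half n) * exp (- (r/2) * half n)"
      using x C half_pos(1)[of n] by (intro mult_mono) (auto simp: S_def intro!: mult_right_mono)
    finally show "norm (- ((-1) ^ n * (half n * b n) * exp (- x * half n))) \<le>
       C * (half n ^ 2 * exp (- (r/2) * half n))"
      by (simp add: power2_eq_square mult_ac)
  qed
  have "((\<lambda>x. \<Sum>n. (-1) ^ n * b n * exp (- x * half n)) has_field_derivative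
        (\<Sum>n. - ((-1) ^ n * (half n * b n) * exp (- r * half n)))) (at r)"
  proof (rule has_field_derivative_series'(2)[OF _ _ conv])
    show "convex S" by (simp add: S_def)
    show "r \<in> S" "r \<in> interior S" using assms by (auto simp: S_def)
    show "summable (\<lambda>n. (-1) ^ n * b n * exp (- r * half n))"
      by (rule alt_dirichlet_summable[OF b2 assms(2)])
    show "((\<lambda>x. (-1) ^ n * b n * exp (- x * half n)) has_field_derivative
       - ((-1) ^ n * (half n * b n) * exp (- x * half n))) (at x within S)" for n x
      by (auto intro!: derivative_eq_intros)
  qed
  also have "(\<Sum>n. - ((-1) ^ n * (half n * b n) * exp (- r * half n))) = - alt_dirichlet (\<lambda>n. half n * b n) r"
    unfolding alt_dirichlet_def by (intro suminf_minus alt_dirichlet_summable b3 assms)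
  finally show ?thesis unfolding alt_dirichlet_def[abs_def] .
qed

text \<open>A geometric series of ratio \<open>- exp (- r)\<close>. The sign of the derivative of
  its closed form is the source of the positivity results below.\<close>

lemma alt_dirichlet_one:
  assumes "r > 0"
  shows "alt_dirichlet (\<lambda>_. 1) r = 1 / (2 * cosh (r / 2))"
proof -
  have e: "exp (- r * half n) = exp (- r / 2) * exp (- r) ^ n" for n
    unfolding exp_of_nat_mult[symmetric] exp_add[symmetric] by (simp add: half_def algebra_simps)
  have "(\<lambda>n. exp (- r / 2) * (- exp (- r)) ^ n) sums (exp (- r / 2) * (1 / (1 - (- exp (- r)))))"
    by (intro sums_mult geometric_sums) (use assms in auto)
  also have "(\<lambda>n. exp (- r / 2) * (- exp (- r)) ^ n) = (\<lambda>n. (-1) ^ n * 1 * exp (- r * half n))"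
    unfolding e by (subst power_minus) (auto simp: mult_ac)
  also have "exp (- r / 2) * (1 / (1 - (- exp (- r)))) = 1 / (2 * cosh (r / 2))"
  proof -
    have "exp (-r) = exp (- r / 2) * exp (- r / 2)" "exp (r / 2) * exp (- r / 2) = 1"
      by (simp_all flip: exp_add)
    hence "2 * cosh (r / 2) * exp (- r / 2) = 1 + exp (-r)"
      by (simp add: cosh_field_def distrib_right)
    moreover have "1 + exp (-r) > 0" by (simp add: add_pos_pos)
    ultimately show ?thesis by (simp add: field_simps)
  qed
  finally show ?thesis unfolding alt_dirichlet_def by (simp add: sums_iff)
qed

lemma alt_dirichlet_tendsto_0:
  assumes "\<And>n. \<bar>b n\<bar> \<le> 1"
  shows "(alt_dirichlet b \<longlongrightarrow> 0) at_top"
proof (rule Lim_null_comparison)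
  show "((\<lambda>r. exp (- r / 2) / (1 - exp (- r))) \<longlongrightarrow> (0::real)) at_top" by real_asymp
  show "\<forall>\<^sub>F r in at_top. norm (alt_dirichlet b r) \<le> exp (- r / 2) / (1 - exp (- r))"
    using eventually_gt_at_top[of 0]
  proof eventually_elim
    case (elim r)
    have e: "exp (- r * half n) = exp (- r / 2) * exp (- r) ^ n" for n
      unfolding exp_of_nat_mult[symmetric] exp_add[symmetric] by (simp add: half_def algebra_simps)
    have "(\<lambda>n. exp (- r / 2) * exp (- r) ^ n) sums (exp (- r / 2) * (1 / (1 - exp (- r))))"
      by (intro sums_mult geometric_sums) (use elim in auto)
    hence s: "(\<lambda>n. exp (- r * half n)) sums (exp (- r / 2) / (1 - exp (- r)))" unfolding e by simp
    have le: "norm ((-1) ^ n * b n * exp (- r * half n)) \<le> exp (- r * half n)" for n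
      using assms[of n] by (simp add: abs_mult)
    have "norm (alt_dirichlet b r) \<le> (\<Sum>n. exp (- r * half n))"
      unfolding alt_dirichlet_def by (rule norm_suminf_le[OF le sums_summable[OF s]])
    thus ?case using s by (simp add: sums_iff)
  qed
qed

text \<open>The series D of the introduction; \<open>2 * exp (r * y)\<close> times it is the
  derivative of the rescaled interpolation error.\<close>

definition ratio_series :: "real \<Rightarrow> real \<Rightarrow> real" where
  "ratio_series y = alt_dirichlet (\<lambda>n. half n / (half n + y))"

text \<open>Write D for the ratio series and s for the geometric sum. Then D = s - y V and V' = -D,
  hence (exp(-t y) D)' = exp(-t y) s' < 0 for t > 0. A strictly decreasing function with limit 0 at
  infinity is positive.\<close>

lemma ratio_series_pos:
  assumes "y \<ge> 0" "r > 0"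
  shows "ratio_series y r > 0"
proof -
  define V where "V = alt_dirichlet (\<lambda>n. 1 / (half n + y))"
  have nz: "half n + y > 0" for n using assms(1) half_pos(1)[of n] by linarith
  have O: "(\<lambda>n. 1 / (half n + y)) \<in> O(\<lambda>n. half n)" "(\<lambda>n. 1 / (half n + y)) \<in> O(\<lambda>n. half n ^ 2)"
    "(\<lambda>n. 1) \<in> O(\<lambda>n. half n ^ 2)"
    unfolding half_def by real_asymp+
  have DV: "ratio_series y t = 1 / (2 * cosh (t / 2)) - y * V t" if "t > 0" for t
  proof -
    have "ratio_series y t = alt_dirichlet (\<lambda>n. 1 * 1 + (-y) * (1 / (half n + y))) t"
      unfolding ratio_series_def
    proof (intro arg_cong2[where f = alt_dirichlet] ext refl)
      show "half n / (half n + y) = 1 * 1 + (- y) * (1 / (half n + y))" for n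
        using nz[of n] by (simp add: field_simps)
    qed
    also have "\<dots> = 1 * alt_dirichlet (\<lambda>n. 1) t + (-y) * V t" unfolding V_def by (rule alt_dirichlet_lincomb[OF O(3,2) that])
    finally show ?thesis using alt_dirichlet_one[OF that] by simp
  qed
  have dV: "(V has_real_derivative - ratio_series y t) (at t)" if "t > 0" for t
    using alt_dirichlet_deriv[OF O(1) that] unfolding V_def ratio_series_def by simp
  define f where "f = (\<lambda>t. exp (- (t * y)) * (1 / (2 * cosh (t / 2)) - y * V t))"
  have df: "(f has_real_derivative exp (- (t * y)) * (- sinh (t/2) / (4 * cosh (t/2) ^ 2))) (at t)" if "t > 0" for t
  proof -
    have c: "cosh (t/2) \<noteq> 0" by (simp add: cosh_real_nonzero)
    have d1: "((\<lambda>t. 1 / (2 * cosh (t / 2))) has_real_derivative - sinh (t/2) / (4 * cosh (t/2) ^ 2)) (at t)"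
      using c by (auto intro!: derivative_eq_intros simp: field_simps power2_eq_square)
    have d2: "((\<lambda>t. exp (- (t * y))) has_real_derivative - y * exp (- (t * y))) (at t)"
      by (auto intro!: derivative_eq_intros)
    have "(f has_real_derivative
        - y * exp (- (t * y)) * (1 / (2 * cosh (t / 2)) - y * V t) +
        (- sinh (t/2) / (4 * cosh (t/2) ^ 2) - y * (- ratio_series y t)) * exp (- (t * y))) (at t)"
      unfolding f_def by (intro DERIV_mult d2 DERIV_diff d1 DERIV_cmult dV that)
    \<comment> \<open>Once \<open>DV\<close> rewrites the ratio series, its two multiples cancel and
      only the derivative of s survives.\<close>
    thus ?thesis unfolding DV[OF that] by (simp add: algebra_simps)
  qed
  have dec: "f a > f b" if "0 < a" "a < b" for a b
  proof (rule DERIV_neg_imp_decreasing[OF that(2)])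
    fix t assume t: "a \<le> t" "t \<le> b"
    hence "sinh (t/2) > 0" using that by simp
    hence "exp (- (t * y)) * (- sinh (t/2) / (4 * cosh (t/2) ^ 2)) < 0"
      by (intro mult_pos_neg divide_neg_pos) auto
    thus "\<exists>y. (f has_real_derivative y) (at t) \<and> y < 0" using df[of t] that t by auto
  qed
  have lim: "(f \<longlongrightarrow> 0) at_top"
  proof (rule Lim_null_comparison)
    have "\<bar>half n / (half n + y)\<bar> \<le> 1" for n using nz[of n] assms(1)
      by (simp add: pos_divide_le_eq)
    hence "(ratio_series y \<longlongrightarrow> 0) at_top" unfolding ratio_series_def by (rule alt_dirichlet_tendsto_0)
    thus "((\<lambda>t. \<bar>ratio_series y t\<bar>) \<longlongrightarrow> 0) at_top" by (rule tendsto_rabs_zero)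
    show "\<forall>\<^sub>F t in at_top. norm (f t) \<le> \<bar>ratio_series y t\<bar>" using eventually_gt_at_top[of 0]
    proof eventually_elim
      case (elim t)
      have "exp (- (t * y)) \<le> 1" using elim assms(1) by simp
      thus ?case unfolding f_def DV[OF elim, symmetric] by (simp add: abs_mult mult_left_le_one_le)
    qed
  qed
  \<comment> \<open>The limit yields only a weak inequality, so it is applied at
    \<open>r + 1\<close>; the strict decrease from \<open>r\<close> to \<open>r + 1\<close> restores
    strictness.\<close>
  have "0 \<le> f (r + 1)"
  proof (rule tendsto_upperbound[OF lim])
    show "\<forall>\<^sub>F i in at_top. f i \<le> f (r + 1)"
      using eventually_gt_at_top[of "r + 1"] by eventually_elim (use dec[of "r+1"] assms(2) in force)
  qed auto
  also have "f (r + 1) < f r" using dec[of r "r+1"] assms(2) by simp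
  also have "f r = exp (- (r * y)) * ratio_series y r" unfolding f_def DV[OF assms(2)] ..
  finally show ?thesis by (simp add: zero_less_mult_iff)
qed

text \<open>Away from the poles this is 1 / (half n - y) + 1 / (half n + y), the contribution of two
  opposite poles of the secant. It is even in y.\<close>

definition pole_pair :: "real \<Rightarrow> nat \<Rightarrow> real" where "pole_pair y n = 2 * half n / ((half n)\<^sup>2 - y\<^sup>2)"

lemma pole_pair_bigo: "pole_pair y \<in> O(\<lambda>n. half n)" "pole_pair y \<in> O(\<lambda>n. half n ^ 2)" 
  "(\<lambda>n. half n * pole_pair y n) \<in> O(\<lambda>n. half n ^ 2)"
  unfolding pole_pair_def half_def by real_asymp+

text \<open>At \<open>r = 0\<close> the series converges only conditionally; consecutive terms are paired to obtain a
  summable majorant that does not depend on \<open>r\<close>.\<close>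

lemma alt_dirichlet_pole_pair_limit:
  assumes "cos (pi * y) \<noteq> 0"
  shows "(alt_dirichlet (pole_pair y) \<longlongrightarrow> pi / cos (pi * y)) (at_right 0)"
proof -
  define h where "h n r = exp (- r * half (2*n)) * pole_pair y (2*n) - exp (- r * half (2*n+1)) * pole_pair y (2*n+1)" for n r
  have alt_dirichlet_h: "alt_dirichlet (pole_pair y) r = (\<Sum>n. h n r)" if "r > 0" for r
  proof -
    from sums_group[OF summable_sums[OF alt_dirichlet_summable[OF pole_pair_bigo(2) that]], of 2]
    have "(\<lambda>n. \<Sum>i=n*2..<n*2+2. (-1) ^ i * pole_pair y i * exp (- r * half i)) sums alt_dirichlet (pole_pair y) r"
      by (simp add: alt_dirichlet_def)
    also have "(\<lambda>n. \<Sum>i=n*2..<n*2+2. (-1) ^ i * pole_pair y i * exp (- r * half i)) = (\<lambda>n. h n r)"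
    proof
      fix n
      have "{n*2..<n*2+2} = {2*n, 2*n+1}" for n :: nat by auto
      thus "(\<Sum>i=n*2..<n*2+2. (-1) ^ i * pole_pair y i * exp (- r * half i)) = h n r"
        by (simp add: h_def)
    qed
    finally show ?thesis by (simp add: sums_iff)
  qed
  have h0: "(\<lambda>n. h n 0) sums (pi / cos (pi * y))"
    using sec_sums[OF assms] by (simp add: h_def pole_pair_def)
  define M where "M n = \<bar>pole_pair y (2*n) - pole_pair y (2*n+1)\<bar> + \<bar>pole_pair y (2*n+1)\<bar> / half (2*n)" for n
  have bnd: "norm (h n r) \<le> M n" if "r > 0" for n r
  proof -
    define a where "a = half (2*n)"
    have a: "a > 0" "half (2*n+1) = a + 1" by (auto simp: a_def) (simp add: half_def)
    \<comment> \<open>The second exponent is a + 1, so exp(-r a) factors out. The difference of the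
      pole pairs is O(n^-2), and exp(-r a) (1 - exp(-r)) is at most 1 / a for every r > 0.\<close>
    have "h n r = exp (- r * a) * (pole_pair y (2*n) - pole_pair y (2*n+1)) + exp (- r * a) * (1 - exp (-r)) * pole_pair y (2*n+1)"
      unfolding h_def a a_def[symmetric] by (simp add: algebra_simps exp_add[symmetric])
    hence "\<bar>h n r\<bar> \<le> \<bar>exp (- r * a) * (pole_pair y (2*n) - pole_pair y (2*n+1))\<bar> + \<bar>exp (- r * a) * (1 - exp (-r)) * pole_pair y (2*n+1)\<bar>"
      by (simp add: abs_triangle_ineq)
    also have "\<dots> = exp (- r * a) * \<bar>pole_pair y (2*n) - pole_pair y (2*n+1)\<bar> + exp (- r * a) * (1 - exp (-r)) * \<bar>pole_pair y (2*n+1)\<bar>"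
      using that by (simp add: abs_mult)
    also have "\<dots> \<le> 1 * \<bar>pole_pair y (2*n) - pole_pair y (2*n+1)\<bar> + (1 / a) * \<bar>pole_pair y (2*n+1)\<bar>"
    proof (intro add_mono mult_right_mono)
      show "exp (- r * a) \<le> 1" using that a by simp
      have "1 - exp (-r) \<le> r" using exp_ge_add_one_self[of "-r"] by simp
      moreover have "r * a \<le> exp (r * a)" using exp_ge_add_one_self[of "r * a"] by linarith
      ultimately have "exp (- r * a) * (1 - exp (-r)) \<le> exp (- r * a) * (exp (r * a) / a)"
        using a by (intro mult_left_mono) (auto simp: pos_le_divide_eq intro: order_trans[OF mult_right_mono])
      also have "\<dots> = 1 / a" using a by (simp add: exp_minus field_simps)
      finally show "exp (- r * a) * (1 - exp (-r)) \<le> 1 / a" .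
    qed auto
    finally show ?thesis by (simp add: M_def a_def)
  qed
  have sm: "summable M"
    unfolding M_def[abs_def]
  proof (intro summable_add; rule summable_comparison_test_bigo)
    show "summable (\<lambda>n. norm (inverse (real n ^ 2)))"
      using inverse_power_summable[of 2, where 'a = real] by simp
    thus "summable (\<lambda>n. norm (inverse (real n ^ 2)))" .
    have "(\<lambda>n. pole_pair y (2*n) - pole_pair y (2*n+1)) \<in> O(\<lambda>n. inverse (real n ^ 2))"
      unfolding pole_pair_def half_def by real_asymp
    thus "(\<lambda>n. \<bar>pole_pair y (2*n) - pole_pair y (2*n+1)\<bar>) \<in> O(\<lambda>n. inverse (real n ^ 2))"
      by simp
    have "(\<lambda>n. pole_pair y (2*n+1) / half (2*n)) \<in> O(\<lambda>n. inverse (real n ^ 2))"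
      unfolding pole_pair_def half_def by real_asymp
    hence "(\<lambda>n. \<bar>pole_pair y (2*n+1) / half (2*n)\<bar>) \<in> O(\<lambda>n. inverse (real n ^ 2))"
      by (simp only: landau_o.big.abs_in_iff)
    thus "(\<lambda>n. \<bar>pole_pair y (2*n+1)\<bar> / half (2*n)) \<in> O(\<lambda>n. inverse (real n ^ 2))"
      by (simp only: abs_divide abs_of_nonneg[OF half_ge_0])
  qed
  have "((\<lambda>r. \<Sum>n. h n r) \<longlongrightarrow> (\<Sum>n. h n 0)) (at_right 0)"
  proof (rule conjunct2[OF conjunct2[OF tannerys_theorem[OF _ _ sm]]])
    show "((\<lambda>r. h n r) \<longlongrightarrow> h n 0) (at_right 0)" for n
      unfolding h_def by (auto intro!: tendsto_eq_intros)
    have "eventually (\<lambda>r::real. r > 0) (at_right 0)" by (simp add: eventually_at_right_less)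
    thus "\<forall>\<^sub>F (k, n) in at_top \<times>\<^sub>F at_right 0. norm (h k n) \<le> M k"
      unfolding case_prod_beta
      by (rule eventually_mono[OF eventually_prodI[OF eventually_True]]) (simp add: bnd[unfolded real_norm_def])
  qed auto
  also have "(\<Sum>n. h n 0) = pi / cos (pi * y)" using h0 by (simp add: sums_iff)
  finally show ?thesis
    by (rule Lim_transform_eventually)
       (auto intro!: eventually_mono[OF eventually_at_right_less[of 0]] simp: alt_dirichlet_h)
qed

text \<open>Multiplied by exp(t y), the expression at t becomes \<open>f\<close>, whose derivative 2
  exp(t y) D is positive and whose limit at t = 0 is 0 by the secant series. Dividing by the cosine
  makes the error one-signed whatever the sign of the cosine.\<close>

lemma interpolation_error_pos:
  assumes "cos (pi * y) \<noteq> 0" "y \<ge> 0" "r > 0"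
  shows "pi * exp (- r * y) / cos (pi * y) - alt_dirichlet (pole_pair y) r > 0"
proof -
  define f where "f = (\<lambda>t. pi / cos (pi * y) - exp (t * y) * alt_dirichlet (pole_pair y) t)"
  have O: "(\<lambda>n. half n / (half n + y)) \<in> O(\<lambda>n. half n ^ 2)" 
    unfolding half_def by real_asymp+
  have df: "(f has_real_derivative 2 * exp (t * y) * ratio_series y t) (at t)" if "t > 0" for t
  proof -
    have "y * alt_dirichlet (pole_pair y) t + (-1) * alt_dirichlet (\<lambda>n. half n * pole_pair y n) t =
       alt_dirichlet (\<lambda>n. y * pole_pair y n + (-1) * (half n * pole_pair y n)) t"
      by (rule alt_dirichlet_lincomb[OF pole_pair_bigo(2,3) that, symmetric])
    \<comment> \<open>The factor half n - y cancels in \<open>pole_pair\<close> and leaves -2 half n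
      / (half n + y). The summand with coefficient 0 fits the expression to the two-series form of
      \<open>alt_dirichlet_lincomb\<close>.\<close>
    also have "\<dots> = alt_dirichlet (\<lambda>n. (-2) * (half n / (half n + y)) + 0 * (half n / (half n + y))) t"
    proof (intro arg_cong2[where f = alt_dirichlet] ext refl)
      fix n
      have nz: "half n - y \<noteq> 0" "half n + y \<noteq> 0" by (rule half_neq[OF assms(1)])+
      have "(half n)\<^sup>2 - y\<^sup>2 = (half n - y) * (half n + y)" by (simp add: power2_eq_square algebra_simps)
      thus "y * pole_pair y n + -1 * (half n * pole_pair y n) = (-2) * (half n / (half n + y)) + 0 * (half n / (half n + y))"
        unfolding pole_pair_def using nz by (simp add: divide_simps) (simp add: algebra_simps)
    qed
    also have "\<dots> = (-2) * ratio_series y t + 0 * ratio_series y t" unfolding ratio_series_def by (rule alt_dirichlet_lincomb[OF O O that])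
    finally have *: "y * alt_dirichlet (pole_pair y) t - alt_dirichlet (\<lambda>n. half n * pole_pair y n) t = -2 * ratio_series y t" by simp
    have "(f has_real_derivative - (exp (t * y) * (y * alt_dirichlet (pole_pair y) t - alt_dirichlet (\<lambda>n. half n * pole_pair y n) t))) (at t)"
      unfolding f_def by (rule derivative_eq_intros alt_dirichlet_deriv[OF pole_pair_bigo(1) that] refl)+ (simp add: algebra_simps)
    thus ?thesis unfolding * by (simp add: mult_ac)
  qed
  have inc: "f a < f b" if "0 < a" "a < b" for a b
  proof (rule DERIV_pos_imp_increasing[OF that(2)])
    fix t assume t: "a \<le> t" "t \<le> b"
    thus "\<exists>y. (f has_real_derivative y) (at t) \<and> 0 < y" using df[of t] that t ratio_series_pos[OF assms(2), of t]
      by (intro exI[of _ "2 * exp (t * y) * ratio_series y t"]) auto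
  qed
  have lim: "(f \<longlongrightarrow> pi / cos (pi * y) - exp (0 * y) * (pi / cos (pi * y))) (at_right 0)"
    unfolding f_def by (intro tendsto_intros alt_dirichlet_pole_pair_limit assms)
  have "0 \<le> f (r / 2)"
  proof (rule tendsto_upperbound)
    show "(f \<longlongrightarrow> 0) (at_right 0)" using lim by simp
    show "\<forall>\<^sub>F i in at_right 0. f i \<le> f (r / 2)"
      using eventually_at_right_real[of 0 "r/2"] assms(3)
      by (auto elim!: eventually_mono intro!: less_imp_le inc)
  qed auto
  also have "\<dots> < f r" using inc[of "r/2" r] assms(3) by simp
  finally have "0 < exp (- r * y) * f r" by simp
  also have "\<dots> = pi * exp (- r * y) / cos (pi * y) - alt_dirichlet (pole_pair y) r"
    unfolding f_def by (simp add: algebra_simps exp_minus field_simps)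
  finally show ?thesis .
qed

subsection \<open>The kernel \<open>K\<close>\<close>

text \<open>The negative integers are enumerated as -n - 1, so two series over the naturals cover
  each integer exactly once.\<close>

lemma has_sum_int_split:
  fixes f :: "int \<Rightarrow> 'a :: {topological_comm_monoid_add, t2_space}"
  assumes "((\<lambda>n. f (int n)) has_sum a) UNIV" "((\<lambda>n. f (- int n - 1)) has_sum b) UNIV"
  shows "(f has_sum (a + b)) UNIV"
proof -
  have "(f has_sum a) {0..}"
    using assms(1) by (subst has_sum_reindex_bij_witness[of _ int nat]) auto
  moreover have "(f has_sum b) {..<0}"
    using assms(2) by (subst has_sum_reindex_bij_witness[of _ "\<lambda>n. - int n - 1" "\<lambda>m. nat (- m - 1)"]) auto
  ultimately have "(f has_sum (a + b)) ({0..} \<union> {..<0})"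
    by (rule has_sum_Un_disjoint) auto
  moreover have "{0..} \<union> {..<0::int} = UNIV" by auto
  ultimately show ?thesis by simp
qed

text \<open>The bilateral sum is folded by pairing \<open>n\<close> with \<open>1 - n\<close>. At half-integers both sides are 0 because the
  vanishing cosine absorbs the junk value of the division by 0.\<close>

lemma K_fun_eq:
  assumes "r > 0"
  shows "K_fun r z = cos (pi * z) / pi * alt_dirichlet (pole_pair z) r"
proof (cases "cos (pi * z) = 0")
  case False
  define f where "f n = (-1) powi n * exp (- r * \<bar>of_int n - 1/2\<bar>) / (z - of_int n + 1/2)" for n :: int
  have fp: "f (int n + 1) = (-1) ^ n * (- 1 / (z - half n)) * exp (- r * half n)" for n
    by (simp add: f_def half_def power_int_add algebra_simps)
  have fm: "f (- int n) = (-1) ^ n * (1 / (z + half n)) * exp (- r * half n)" for n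
  proof -
    have "\<bar>- real n - 1 / 2\<bar> = half n" "inverse ((-1) ^ n) = ((-1) ^ n :: real)"
      by (simp_all add: half_def power_inverse[symmetric])
    thus ?thesis by (simp add: f_def power_int_minus half_def algebra_simps)
  qed
  have O: "(\<lambda>n. - 1 / (z - half n)) \<in> O(\<lambda>n. half n ^ 2)" "(\<lambda>n. 1 / (z + half n)) \<in> O(\<lambda>n. half n ^ 2)"
    unfolding half_def by real_asymp+
  have hs: "((\<lambda>n. (-1) ^ n * b n * exp (- r * half n)) has_sum alt_dirichlet b r) UNIV"
    if "b \<in> O(\<lambda>n. half n ^ 2)" for b
    unfolding alt_dirichlet_def
    by (intro norm_summable_imp_has_sum summable_sums alt_dirichlet_summable that assms)
       (use alt_dirichlet_summable_norm[OF that assms] in \<open>simp add: abs_mult\<close>)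
  \<comment> \<open>The shift by one turns the reflection n -> 1 - n into n -> -n - 1, the form used
    by \<open>has_sum_int_split\<close>.\<close>
  have "((\<lambda>n. f (n + 1)) has_sum (alt_dirichlet (\<lambda>n. - 1 / (z - half n)) r + alt_dirichlet (\<lambda>n. 1 / (z + half n)) r)) UNIV"
  proof (rule has_sum_int_split)
    show "((\<lambda>n. f (int n + 1)) has_sum alt_dirichlet (\<lambda>n. - 1 / (z - half n)) r) UNIV"
      unfolding fp by (rule hs[OF O(1)])
    have "((\<lambda>n. f (- int n)) has_sum alt_dirichlet (\<lambda>n. 1 / (z + half n)) r) UNIV"
      unfolding fm by (rule hs[OF O(2)])
    thus "((\<lambda>n. f (- int n - 1 + 1)) has_sum alt_dirichlet (\<lambda>n. 1 / (z + half n)) r) UNIV" by simp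
  qed
  also have "?this \<longleftrightarrow> (f has_sum (alt_dirichlet (\<lambda>n. - 1 / (z - half n)) r + alt_dirichlet (\<lambda>n. 1 / (z + half n)) r)) UNIV"
    by (rule has_sum_reindex_bij_witness[of _ "\<lambda>n. n - 1" "\<lambda>n. n + 1"]) auto
  finally have "infsum f UNIV = alt_dirichlet (\<lambda>n. - 1 / (z - half n)) r + alt_dirichlet (\<lambda>n. 1 / (z + half n)) r"
    by (rule infsumI)
  also have "\<dots> = alt_dirichlet (\<lambda>n. 1 * (- 1 / (z - half n)) + 1 * (1 / (z + half n))) r"
    by (subst alt_dirichlet_lincomb[OF O assms]) simp
  also have "(\<lambda>n. 1 * (- 1 / (z - half n)) + 1 * (1 / (z + half n))) = pole_pair z"
  proof
    fix n
    have nz: "half n - z \<noteq> 0" "z + half n \<noteq> 0" by (rule half_neq[OF False])+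
    have e: "(half n)\<^sup>2 - z\<^sup>2 = (half n - z) * (z + half n)" by (simp add: power2_eq_square algebra_simps)
    have e2: "- 1 / (z - half n) = 1 / (half n - z)" using minus_divide_divide[of 1 "half n - z"] by simp
    show "1 * (- 1 / (z - half n)) + 1 * (1 / (z + half n)) = pole_pair z n"
      unfolding pole_pair_def e e2 using nz by (simp add: add_divide_distrib[symmetric] add_frac_eq)
  qed
  finally show ?thesis by (simp add: K_fun_def f_def)
qed (simp add: K_fun_def)

text \<open>The cosine vanishes at both poles, which keeps the product bounded near them, and far
  away the pair decays like 1 / z^2. Quadratic growth in n is harmless against the exponential
  weights, while the decay in z serves both lattice sums and integrals.\<close>

lemma pole_pair_bound:
  "\<bar>cos (pi * z) / pi * pole_pair z n\<bar> \<le> 2 * (1 + 4 * (half n)\<^sup>2) / (1 + z\<^sup>2)"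
proof (cases "cos (pi * z) = 0")
  case False
  define a where "a = half n"
  have a: "a > 0" by (simp add: a_def)
  have nz: "a - z \<noteq> 0" "a + z \<noteq> 0" unfolding a_def by (rule half_neq[OF False])+
  have e: "a\<^sup>2 - z\<^sup>2 = (a - z) * (a + z)" by (simp add: power2_eq_square algebra_simps)
  have p1: "1 + z\<^sup>2 > 0" by (simp add: add_pos_nonneg)
  show ?thesis
  \<comment> \<open>For |z| <= 2 a the bound 2 is enough, because then 1 + z^2 <= 1 + 4 a^2; beyond
    that z^2 - a^2 exceeds 3/4 z^2.\<close>
  proof (cases "\<bar>z\<bar> \<le> 2 * a")
    case True
    have ca: "cos (pi * a) = 0" unfolding a_def by (rule cos_half_eq_0)
    have sa: "\<bar>sin (pi * a)\<bar> = 1" using sin_cos_squared_add[of "pi * a"] ca by (simp add: power2_eq_1_iff) (auto simp: abs_if)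
    have b1: "\<bar>cos (pi * z)\<bar> \<le> pi * \<bar>a - z\<bar>"
    proof -
      have "\<bar>cos (pi * z)\<bar> = \<bar>sin (pi * (a - z))\<bar>" by (simp add: right_diff_distrib sin_diff ca abs_mult sa)
      also have "\<dots> \<le> \<bar>pi * (a - z)\<bar>" by (rule abs_sin_x_le_abs_x)
      finally show ?thesis by (simp add: abs_mult)
    qed
    have b2: "\<bar>cos (pi * z)\<bar> \<le> pi * \<bar>a + z\<bar>"
    proof -
      have "\<bar>cos (pi * z)\<bar> = \<bar>sin (pi * (a + z))\<bar>" by (simp add: distrib_left sin_add ca abs_mult sa)
      also have "\<dots> \<le> \<bar>pi * (a + z)\<bar>" by (rule abs_sin_x_le_abs_x)
      finally show ?thesis by (simp add: abs_mult)
    qed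
    have "cos (pi * z) / pi * pole_pair z n = cos (pi * z) / (pi * (a - z)) + cos (pi * z) / (pi * (a + z))"
      unfolding pole_pair_def a_def[symmetric] e using nz by (simp add: divide_simps) (simp add: algebra_simps)
    also have "\<bar>\<dots>\<bar> \<le> \<bar>cos (pi * z) / (pi * (a - z))\<bar> + \<bar>cos (pi * z) / (pi * (a + z))\<bar>"
      by (rule abs_triangle_ineq)
    also have "\<dots> \<le> 1 + 1"
      using b1 b2 nz by (intro add_mono) (simp_all add: abs_divide abs_mult divide_le_eq)
    also have "\<dots> \<le> 2 * (1 + 4 * a\<^sup>2) / (1 + z\<^sup>2)"
    proof -
      have "z\<^sup>2 \<le> (2 * a)\<^sup>2" using True abs_le_square_iff[of z "2 * a"] a by simp
      thus ?thesis using p1 by (simp add: pos_le_divide_eq power_mult_distrib)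
    qed
    finally show ?thesis by (simp add: a_def)
  next
    case F: False
    have z1: "\<bar>z\<bar> > 2 * a" using F by simp
    have "(2 * a)\<^sup>2 < \<bar>z\<bar>\<^sup>2" using z1 a by (intro power_strict_mono) auto
    hence z2: "z\<^sup>2 > 4 * a\<^sup>2" by (simp add: power_mult_distrib)
    have a2: "a \<ge> 1/2" by (simp add: a_def half_def)
    have a4: "4 * a\<^sup>2 \<ge> 1" using power_mono[OF a2, of 2] by (simp add: power2_eq_square)
    have "\<bar>cos (pi * z) / pi * pole_pair z n\<bar> = \<bar>cos (pi * z)\<bar> / pi * (2 * a / (z\<^sup>2 - a\<^sup>2))"
    proof -
      have "\<bar>a\<^sup>2 - z\<^sup>2\<bar> = z\<^sup>2 - a\<^sup>2" using z2 a by (simp add: abs_if) (smt (verit) zero_le_power2)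
      thus ?thesis using a by (simp add: pole_pair_def a_def[symmetric] abs_mult abs_divide)
    qed
    also have "\<dots> \<le> 1 * (2 * a / (z\<^sup>2 - a\<^sup>2))"
    proof (rule mult_right_mono)
      have "\<bar>cos (pi * z)\<bar> \<le> 1" by simp
      also have "1 \<le> pi" using pi_gt3 by simp
      finally show "\<bar>cos (pi * z)\<bar> / pi \<le> 1" by simp
      have "z\<^sup>2 - a\<^sup>2 \<ge> 0" using z2 a by (smt (verit) zero_le_power2)
      thus "0 \<le> 2 * a / (z\<^sup>2 - a\<^sup>2)" using a by simp
    qed
    also have "\<dots> \<le> 2 * (1 + 4 * a\<^sup>2) / (1 + z\<^sup>2)"
    proof -
      have "2 * a * (1 + z\<^sup>2) \<le> 2 * a * (2 * z\<^sup>2)" using z2 a4 a by (intro mult_left_mono) auto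
      also have "\<dots> = (4 * a) * z\<^sup>2" by simp
      \<comment> \<open>The coefficient is 3/4 of \<open>2 * (1 + 4 * a^2)\<close>, in preparation
        for z^2 - a^2 >= 3/4 z^2.\<close>
      also have "\<dots> \<le> (3 / 2 + 6 * a\<^sup>2) * z\<^sup>2"
      proof (rule mult_right_mono)
        have "0 \<le> 6 * (a - 1/3)\<^sup>2 + 5/6" by simp
        also have "\<dots> = 3 / 2 + 6 * a\<^sup>2 - 4 * a" by (simp add: power2_diff algebra_simps power2_eq_square)
        finally show "4 * a \<le> 3 / 2 + 6 * a\<^sup>2" by simp
      qed simp
      also have "\<dots> = 2 * (1 + 4 * a\<^sup>2) * (3 / 4 * z\<^sup>2)" by (simp add: algebra_simps)
      also have "\<dots> \<le> 2 * (1 + 4 * a\<^sup>2) * (z\<^sup>2 - a\<^sup>2)" using z2 by (intro mult_left_mono) auto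
      finally have "2 * a * (1 + z\<^sup>2) \<le> 2 * (1 + 4 * a\<^sup>2) * (z\<^sup>2 - a\<^sup>2)" .
      moreover have "z\<^sup>2 - a\<^sup>2 > 0" using z2 a by (smt (verit) zero_le_power2)
      ultimately show ?thesis using p1 by (simp add: divide_simps mult_ac)
    qed
    finally show ?thesis by (simp add: a_def)
  qed
qed simp

subsection \<open>Periodization of \<open>K\<close>\<close>

text \<open>A half-open window pairs off completely as n and -n - 1, without an unpaired middle
  term; this is the grouping of \<open>cot_sums\<close>.\<close>

lemma sum_int_symmetric:
  fixes f :: "int \<Rightarrow> 'a :: ab_group_add"
  shows "(\<Sum>m\<in>{- int k..<int k}. f m) = (\<Sum>n<k. f (int n) + f (- int n - 1))"
proof (induction k)
  case (Suc k)
  have "{- int (Suc k)..<int (Suc k)} = insert (int k) (insert (- int k - 1) {- int k..<int k})" by auto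
  thus ?case using Suc by (simp add: algebra_simps)
qed simp

text \<open>Divided by sin t, this writes sin(2 (N + 1) t) cot t as the Dirichlet kernel of degree N
  plus one further cosine. The form without division allows induction at every t.\<close>

lemma dirichlet_kernel:
  "sin (2 * real (Suc N) * t) * cos t =
     sin t * (1 + 2 * (\<Sum>j=1..N. cos (2 * real j * t)) + cos (2 * real (Suc N) * t))"
proof (induction N)
  case 0
  have "sin (2 * t) * cos t = sin t * (1 + cos (2 * t))"
    unfolding sin_double cos_double_cos by (simp add: algebra_simps power2_eq_square)
  thus ?case by simp
next
  case (Suc N)
  \<comment> \<open>The midpoint of two consecutive frequencies: passing from one to the next
    changes each side by 2 cos u sin t cos t.\<close>
  define u where "u = (2 * real (Suc N) + 1) * t"
  have e: "2 * real (Suc N) * t = u - t" "2 * real (Suc (Suc N)) * t = u + t"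
    by (simp_all add: u_def algebra_simps)
  have "sin (u + t) * cos t - sin (u - t) * cos t = sin t * (cos (u - t) + cos (u + t))"
    by (simp add: sin_add sin_diff cos_add cos_diff algebra_simps)
  with Suc show ?case unfolding sum.atLeast_Suc_atMost_Suc_shift[symmetric] 
    by (simp only: e sum.cl_ivl_Suc) (simp add: algebra_simps e)
qed

lemma cot_periodization:
  fixes x b :: real
  assumes "x + b \<notin> \<int>" "x - b \<notin> \<int>"
  shows "(\<lambda>k. \<Sum>m\<in>{- int k..<int k}. 1 / (x + of_int m + b) - 1 / (x + of_int m - b))
          \<longlonglongrightarrow> pi * cot (pi * (x + b)) - pi * cot (pi * (x - b))"
proof -
  have eq: "(1 / (x + real n + b) - 1 / (x + real n - b)) + (1 / (x - 1 - real n + b) - 1 / (x - 1 - real n - b)) =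
     1 / (x + b + real n) + 1 / (x + b - 1 - real n) - (1 / (x - b + real n) + 1 / (x - b - 1 - real n))" for n
  proof -
    have *: "x + real n + b = x + b + real n" "x + real n - b = x - b + real n"
      "x - 1 - real n + b = x + b - 1 - real n" "x - 1 - real n - b = x - b - 1 - real n" by auto
    show ?thesis unfolding * by (rule add_diff_add[symmetric])
  qed
  have "(\<lambda>n. (1 / (x + real n + b) - 1 / (x + real n - b)) + (1 / (x - 1 - real n + b) - 1 / (x - 1 - real n - b)))
     sums (pi * cot (pi * (x + b)) - pi * cot (pi * (x - b)))"
    unfolding eq by (intro sums_diff cot_sums assms)
  thus ?thesis unfolding sums_def sum_int_symmetric by (simp add: algebra_simps)
qed

text \<open>For j <= N this turns out to be \<open>K_hat\<close> at j / (2 N + 2), divided by 2 N +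
  2. No alternating sign remains, because (-1)^n meets sin(pi half n) = (-1)^n.\<close>

definition interp_coeff :: "nat \<Rightarrow> real \<Rightarrow> nat \<Rightarrow> real" where
  "interp_coeff N r j = (\<Sum>n. cos (pi * half n * real j / real (Suc N)) * exp (- r * half n)) / real (Suc N)"

text \<open>The even trigonometric polynomial whose Fourier coefficients at j and -j are both
  \<open>d j\<close>, whence the factor 2.\<close>

definition cos_poly :: "nat \<Rightarrow> (nat \<Rightarrow> real) \<Rightarrow> real \<Rightarrow> real" where
  "cos_poly N d x = d 0 + 2 * (\<Sum>j=1..N. d j * cos (2 * pi * real j * x))"

lemma cos_shift_int:
  assumes M: "M = real (Suc N)"
  shows "cos (pi * (2 * M * (x + of_int m))) = cos (2 * pi * M * x)"
proof -
  have ph: "pi * (2 * M * (x + of_int m)) = 2 * pi * M * x + 2 * pi * of_int (int (Suc N) * m)"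
    by (simp add: M algebra_simps)
  show ?thesis
    unfolding ph cos_add using cos_int_2pin[of "int (Suc N) * m"] sin_int_2pin[of "int (Suc N) * m"]
    by (simp only: mult_1_right mult_zero_right diff_zero)
qed

text \<open>Along the lattice x + m the cosine is constant and the pole pairs sum to a difference of
  cotangents with poles at -b and b. By \<open>dirichlet_kernel\<close> each cotangent times the
  cosine is a Dirichlet kernel up to a multiple of sin(2 pi M x), and the two multiples
  cancel.\<close>

lemma pole_pair_periodization:
  assumes M: "M = real (Suc N)" and x: "cos (2 * pi * M * x) \<noteq> 0"
  shows "(\<lambda>k. \<Sum>m\<in>{- int k..<int k}. (-1) ^ n * (cos (pi * (2 * M * (x + of_int m))) / pi * pole_pair (2 * M * (x + of_int m)) n))
          \<longlonglongrightarrow> cos_poly N (\<lambda>j. cos (pi * half n * real j / M)) x / M"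
proof -
  define b where "b = half n / (2 * M)"
  have Mp: "M > 0" by (simp add: M)
  have cm: "cos (pi * (2 * M * (x + of_int m))) = cos (2 * pi * M * x)" for m
    by (rule cos_shift_int[OF M])
  have nz: "half n - 2 * M * (x + of_int m) \<noteq> 0" "half n + 2 * M * (x + of_int m) \<noteq> 0" for m
    using half_neq[of "2 * M * (x + of_int m)" n] x cm[of m] by auto
  have xb: "x + b \<notin> \<int>" "x - b \<notin> \<int>"
  proof -
    show "x + b \<notin> \<int>"
    proof
      assume "x + b \<in> \<int>"
      then obtain m where "x + b = of_int m" by (auto elim: Ints_cases)
      hence "half n + 2 * M * (x + of_int (- m)) = 0" using Mp by (simp add: b_def field_simps)
      thus False using nz(2)[of "- m"] by simp
    qed
    show "x - b \<notin> \<int>"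
    proof
      assume "x - b \<in> \<int>"
      then obtain m where "x - b = of_int m" by (auto elim: Ints_cases)
      hence "half n - 2 * M * (x + of_int (- m)) = 0" using Mp by (simp add: b_def field_simps)
      thus False using nz(1)[of "- m"] by simp
    qed
  qed
  have g: "pole_pair (2 * M * (x + of_int m)) n = (1 / (x + of_int m + b) - 1 / (x + of_int m - b)) / (2 * M)" for m
  proof -
    define z where "z = 2 * M * (x + of_int m)"
    have e: "x + of_int m + b = (half n + z) / (2 * M)" "x + of_int m - b = - ((half n - z) / (2 * M))"
      using Mp by (simp_all add: b_def z_def field_simps)
    have e2: "(half n)\<^sup>2 - z\<^sup>2 = (half n - z) * (half n + z)" by (simp add: power2_eq_square algebra_simps)
    have nz': "half n - z \<noteq> 0" "half n + z \<noteq> 0" using nz[of m] by (simp_all add: z_def)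
    show ?thesis unfolding e z_def[symmetric] pole_pair_def e2 using nz' Mp by (simp add: divide_simps) (simp add: algebra_simps)
  qed
  define C where "C = cos (2 * pi * M * x)"
  define S where "S = sin (2 * pi * M * x)"
  have half_trig: "sin (pi * half n) = (-1) ^ n" "cos (pi * half n) = 0"
    by (simp_all add: half_def distrib_left sin_add cos_add)
  have "(\<lambda>k. (-1) ^ n * C / (2 * pi * M) * (\<Sum>m\<in>{- int k..<int k}. 1 / (x + of_int m + b) - 1 / (x + of_int m - b)))
     \<longlonglongrightarrow> (-1) ^ n * C / (2 * pi * M) * (pi * cot (pi * (x + b)) - pi * cot (pi * (x - b)))"
    by (intro tendsto_intros cot_periodization xb)
  also have "(\<lambda>k. (-1) ^ n * C / (2 * pi * M) * (\<Sum>m\<in>{- int k..<int k}. 1 / (x + of_int m + b) - 1 / (x + of_int m - b)))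
     = (\<lambda>k. \<Sum>m\<in>{- int k..<int k}. (-1) ^ n * (cos (pi * (2 * M * (x + of_int m))) / pi * pole_pair (2 * M * (x + of_int m)) n))"
    unfolding cm g C_def[symmetric] sum_distrib_left by (intro ext sum.cong refl) (simp add: mult_ac)
  also have "(-1) ^ n * C / (2 * pi * M) * (pi * cot (pi * (x + b)) - pi * cot (pi * (x - b))) =
     cos_poly N (\<lambda>j. cos (pi * half n * real j / M)) x / M"
  proof -
    define A where "A y = 1 + 2 * (\<Sum>j=1..N. cos (2 * real j * (pi * y)))" for y
    have dk: "sin (2 * M * (pi * y)) * cot (pi * y) = A y + cos (2 * M * (pi * y))" if "y \<notin> \<int>" for y
    proof -
      have "sin (pi * y) \<noteq> 0" using that by (auto simp: sin_zero_iff_int2 mult.commute)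
      thus ?thesis using dirichlet_kernel[of N "pi * y"] unfolding A_def M cot_def by (simp add: field_simps)
    qed
    have pb: "2 * M * (pi * (x + b)) = 2 * pi * M * x + pi * half n" "2 * M * (pi * (x - b)) = 2 * pi * M * x - pi * half n"
      using Mp by (simp_all add: b_def field_simps)
    \<comment> \<open>Shifting the phase by pi half n turns the sine into (-1)^n C; this is where
      the alternating sign is used up.\<close>
    have "(-1) ^ n * C * cot (pi * (x + b)) = A (x + b) - (-1) ^ n * S"
      using dk[OF xb(1)] unfolding pb sin_add cos_add half_trig C_def S_def by (simp add: algebra_simps)
    moreover have "- ((-1) ^ n * C) * cot (pi * (x - b)) = A (x - b) + (-1) ^ n * S"
      using dk[OF xb(2)] unfolding pb sin_diff cos_diff half_trig C_def S_def by (simp add: algebra_simps)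
    ultimately have "(-1) ^ n * C * (cot (pi * (x + b)) - cot (pi * (x - b))) = A (x + b) + A (x - b)"
      by (simp add: algebra_simps)
    also have "\<dots> = 2 * cos_poly N (\<lambda>j. cos (pi * half n * real j / M)) x"
    proof -
      have "cos (2 * real j * (pi * (x + b))) + cos (2 * real j * (pi * (x - b))) =
         2 * (cos (pi * half n * real j / M) * cos (2 * pi * real j * x))" for j
      proof -
        have "2 * real j * (pi * (x + b)) = 2 * pi * real j * x + pi * half n * real j / M"
             "2 * real j * (pi * (x - b)) = 2 * pi * real j * x - pi * half n * real j / M"
          using Mp by (simp_all add: b_def field_simps)
        thus ?thesis by (simp add: cos_add cos_diff)
      qed
      hence "(\<Sum>j=1..N. cos (2 * real j * (pi * (x + b)))) + (\<Sum>j=1..N. cos (2 * real j * (pi * (x - b))))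
        = 2 * (\<Sum>j=1..N. cos (pi * half n * real j / M) * cos (2 * pi * real j * x))"
        by (simp add: sum.distrib[symmetric] sum_distrib_left)
      thus ?thesis by (simp add: A_def cos_poly_def)
    qed
    finally have *: "(-1) ^ n * C * (cot (pi * (x + b)) - cot (pi * (x - b))) = 
       2 * cos_poly N (\<lambda>j. cos (pi * half n * real j / M)) x" .
    have "(-1) ^ n * C / (2 * pi * M) * (pi * cot (pi * (x + b)) - pi * cot (pi * (x - b))) =
      ((-1) ^ n * C * (cot (pi * (x + b)) - cot (pi * (x - b)))) / (2 * M)"
      using Mp by (simp add: field_simps)
    thus ?thesis unfolding * by simp
  qed
  finally show ?thesis .
qed

section \<open>Uniform bounds for lattice sums\<close>

definition lattice_bound :: real where "lattice_bound = 2 * (\<Sum>n. 1 / (1 + (real n)\<^sup>2))"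

lemma summable_inverse_one_plus_square: "summable (\<lambda>n. 1 / (1 + (real n)\<^sup>2))"
proof (rule summable_comparison_test_bigo)
  show "summable (\<lambda>n. norm (inverse (real n ^ 2)))"
    using inverse_power_summable[of 2, where 'a = real] by simp
  show "(\<lambda>n. 1 / (1 + (real n)\<^sup>2)) \<in> O(\<lambda>n. inverse (real n ^ 2))" by real_asymp
qed

text \<open>Since 0 <= x <= 1, |x + m| >= n both for m = n and for m = -n - 1. Each pair of terms is
  thus at most 2 / (1 + n^2), independently of x, M and k.\<close>

lemma lattice_sum_le:
  assumes "0 \<le> x" "x \<le> 1" "M \<ge> 1"
  shows "(\<Sum>m\<in>{- int k..<int k}. 1 / (1 + (M * (x + of_int m))\<^sup>2)) \<le> lattice_bound"
proof -
  have mono: "1 / (1 + (M * y)\<^sup>2) \<le> 1 / (1 + (real n)\<^sup>2)" if "real n \<le> \<bar>y\<bar>" for y n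
  proof -
    have "real n \<le> \<bar>M * y\<bar>" using that assms(3) mult_mono[of 1 M "real n" "\<bar>y\<bar>"] by (simp add: abs_mult)
    hence "(real n)\<^sup>2 \<le> (M * y)\<^sup>2" using abs_le_square_iff[of "real n" "M * y"] by simp
    thus ?thesis by (intro divide_left_mono) (auto simp: add_pos_nonneg)
  qed
  have "(\<Sum>m\<in>{- int k..<int k}. 1 / (1 + (M * (x + of_int m))\<^sup>2)) =
     (\<Sum>n<k. 1 / (1 + (M * (x + of_int (int n)))\<^sup>2) + 1 / (1 + (M * (x + of_int (- int n - 1)))\<^sup>2))"
    by (rule sum_int_symmetric)
  also have "\<dots> \<le> (\<Sum>n<k. 1 / (1 + (real n)\<^sup>2) + 1 / (1 + (real n)\<^sup>2))"
    using assms by (intro sum_mono add_mono mono) auto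
  also have "\<dots> = 2 * (\<Sum>n<k. 1 / (1 + (real n)\<^sup>2))" by (simp add: sum_distrib_left)
  also have "\<dots> \<le> lattice_bound" unfolding lattice_bound_def
    by (intro mult_left_mono sum_le_suminf summable_inverse_one_plus_square) auto
  finally show ?thesis .
qed

text \<open>The factor of the bound on the n-th term of \<open>K\<close> that is independent of z;
  the decay 1 / (1 + z^2) is split off.\<close>

definition K_majorant :: "real \<Rightarrow> nat \<Rightarrow> real" where
  "K_majorant r n = 2 * (1 + 4 * (half n)\<^sup>2) * exp (- r * half n)"

lemma summable_K_majorant:
  assumes "r > 0" shows "summable (K_majorant r)"
proof -
  have "summable (\<lambda>n. \<bar>2 * (1 + 4 * (half n)\<^sup>2)\<bar> * exp (- r * half n))"
  proof (rule alt_dirichlet_summable_norm[OF _ assms])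
    show "(\<lambda>n. 2 * (1 + 4 * (half n)\<^sup>2)) \<in> O(\<lambda>n. half n ^ 2)" unfolding half_def by real_asymp
  qed
  thus ?thesis unfolding K_majorant_def[abs_def] by (simp add: abs_of_nonneg add_nonneg_nonneg)
qed

lemma K_fun_sums:
  assumes "r > 0"
  shows "(\<lambda>n. (-1) ^ n * (cos (pi * z) / pi * pole_pair z n) * exp (- r * half n)) sums K_fun r z"
proof -
  have "(\<lambda>n. cos (pi * z) / pi * ((-1) ^ n * pole_pair z n * exp (- r * half n))) sums (cos (pi * z) / pi * alt_dirichlet (pole_pair z) r)"
    unfolding alt_dirichlet_def by (intro sums_mult summable_sums alt_dirichlet_summable pole_pair_bigo assms)
  thus ?thesis unfolding K_fun_eq[OF assms] by (simp add: mult_ac)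
qed

lemma K_term_bound:
  "\<bar>(-1) ^ n * (cos (pi * z) / pi * pole_pair z n) * exp (- r * half n)\<bar> \<le> K_majorant r n * (1 / (1 + z\<^sup>2))"
proof -
  have "\<bar>(-1) ^ n * (cos (pi * z) / pi * pole_pair z n) * exp (- r * half n)\<bar> = \<bar>cos (pi * z) / pi * pole_pair z n\<bar> * exp (- r * half n)"
    by (simp add: abs_mult)
  also have "\<dots> \<le> 2 * (1 + 4 * (half n)\<^sup>2) / (1 + z\<^sup>2) * exp (- r * half n)"
    by (intro mult_right_mono pole_pair_bound) auto
  finally show ?thesis by (simp add: K_majorant_def mult_ac)
qed

lemma K_fun_bound:
  assumes "r > 0"
  shows "\<bar>K_fun r z\<bar> \<le> suminf (K_majorant r) * (1 / (1 + z\<^sup>2))"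
proof -
  have s: "summable (\<lambda>n. K_majorant r n * (1 / (1 + z\<^sup>2)))" by (intro summable_mult2 summable_K_majorant assms)
  have "norm (K_fun r z) \<le> (\<Sum>n. K_majorant r n * (1 / (1 + z\<^sup>2)))"
    using norm_suminf_le[OF K_term_bound[of _ z r, folded real_norm_def] s] K_fun_sums[OF assms, of z] by (simp add: sums_iff)
  also have "\<dots> = suminf (K_majorant r) * (1 / (1 + z\<^sup>2))" by (rule suminf_mult2[symmetric, OF summable_K_majorant[OF assms]])
  finally show ?thesis by simp
qed

lemma suminf_K_majorant_nonneg: "r > 0 \<Longrightarrow> suminf (K_majorant r) \<ge> 0"
  by (intro suminf_nonneg summable_K_majorant) (auto simp: K_majorant_def add_nonneg_nonneg)

text \<open>Each term converges over the windows by \<open>pole_pair_periodization\<close>, and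
  Tannery's theorem, with majorant \<open>K_majorant r n * lattice_bound\<close>, interchanges this
  limit with the sum over n.\<close>

lemma K_periodization:
  assumes M: "M = real (Suc N)" and x: "cos (2 * pi * M * x) \<noteq> 0" "0 \<le> x" "x \<le> 1" and r: "r > 0"
  shows "(\<lambda>k. \<Sum>m\<in>{- int k..<int k}. K_fun r (2 * M * (x + of_int m))) \<longlonglongrightarrow> cos_poly N (interp_coeff N r) x"
proof -
  define c where "c n k = (\<Sum>m\<in>{- int k..<int k}. (-1) ^ n * (cos (pi * (2 * M * (x + of_int m))) / pi * pole_pair (2 * M * (x + of_int m)) n) * exp (- r * half n))" for n k
  define t where "t n = cos_poly N (\<lambda>j. cos (pi * half n * real j / M)) x / M * exp (- r * half n)" for n
  have "(\<Sum>m\<in>{- int k..<int k}. K_fun r (2 * M * (x + of_int m))) = (\<Sum>n. c n k)" for k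
    unfolding c_def by (rule sums_unique) (intro sums_sum K_fun_sums r)
  moreover have "(\<lambda>k. \<Sum>n. c n k) \<longlonglongrightarrow> (\<Sum>n. t n)"
  proof (rule conjunct2[OF conjunct2[OF tannerys_theorem]])
    show "(c n) \<longlonglongrightarrow> t n" for n
      unfolding c_def[abs_def] t_def sum_distrib_right[symmetric]
      by (intro tendsto_mult pole_pair_periodization M x tendsto_const)
    show "summable (\<lambda>n. K_majorant r n * lattice_bound)" by (intro summable_mult2 summable_K_majorant r)
    have "norm (c n k) \<le> K_majorant r n * lattice_bound" for n k
    proof -
      have "norm (c n k) \<le> (\<Sum>m\<in>{- int k..<int k}. K_majorant r n * (1 / (1 + (2 * M * (x + of_int m))\<^sup>2)))"
        unfolding c_def by (rule order_trans[OF norm_sum sum_mono]) (unfold real_norm_def, rule K_term_bound)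
      also have "\<dots> = K_majorant r n * (\<Sum>m\<in>{- int k..<int k}. 1 / (1 + (2 * M * (x + of_int m))\<^sup>2))"
        by (simp only: sum_distrib_left)
      also have "\<dots> \<le> K_majorant r n * lattice_bound"
        using x M by (intro mult_left_mono lattice_sum_le) (auto simp: K_majorant_def add_nonneg_nonneg)
      finally show ?thesis .
    qed
    thus "\<forall>\<^sub>F (k, n) in sequentially \<times>\<^sub>F sequentially. norm (c k n) \<le> K_majorant r k * lattice_bound"
      by (intro always_eventually) auto
  qed auto
  moreover have "(\<Sum>n. t n) = cos_poly N (interp_coeff N r) x"
  proof -
    have s: "summable (\<lambda>n. cos (pi * half n * real j / M) * exp (- r * half n))" for j
    proof (rule summable_comparison_test')
      have "summable (\<lambda>n. \<bar>1\<bar> * exp (- r * half n))"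
        by (rule alt_dirichlet_summable_norm[OF _ r]) (unfold half_def, real_asymp)
      thus "summable (\<lambda>n. exp (- r * half n))" by simp
    qed (auto simp: abs_mult)
    have j: "(\<lambda>n. cos (pi * half n * real j / M) * exp (- r * half n)) sums (M * interp_coeff N r j)" for j
      using summable_sums[OF s[of j]] by (simp add: interp_coeff_def M)
    \<comment> \<open>As \<open>cos_poly\<close> is linear in its coefficients, the sum over n can
      be taken frequency by frequency.\<close>
    have "(\<lambda>n. (cos (pi * half n * real 0 / M) * exp (- r * half n) + 2 * (\<Sum>j=1..N. (cos (pi * half n * real j / M) * exp (- r * half n)) * cos (2 * pi * real j * x))) / M)
       sums ((M * interp_coeff N r 0 + 2 * (\<Sum>j=1..N. M * interp_coeff N r j * cos (2 * pi * real j * x))) / M)"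
      by (intro sums_divide sums_add sums_mult sums_sum sums_mult2 j)
    moreover have "(M * interp_coeff N r 0 + 2 * (\<Sum>j=1..N. M * interp_coeff N r j * cos (2 * pi * real j * x))) / M = cos_poly N (interp_coeff N r) x"
      using M by (simp add: cos_poly_def field_simps sum_distrib_left)
    moreover have "(\<lambda>n. (cos (pi * half n * real 0 / M) * exp (- r * half n) + 2 * (\<Sum>j=1..N. (cos (pi * half n * real j / M) * exp (- r * half n)) * cos (2 * pi * real j * x))) / M) = t"
    proof
      fix n
      have "(\<Sum>j=1..N. (cos (pi * half n * real j / M) * exp (- r * half n)) * cos (2 * pi * real j * x)) =
        exp (- r * half n) * (\<Sum>j=1..N. cos (pi * half n * real j / M) * cos (2 * pi * real j * x))"
        by (simp add: sum_distrib_left mult_ac)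
      thus "(cos (pi * half n * real 0 / M) * exp (- r * half n) + 2 * (\<Sum>j=1..N. (cos (pi * half n * real j / M) * exp (- r * half n)) * cos (2 * pi * real j * x))) / M = t n"
        by (simp add: t_def cos_poly_def algebra_simps add_divide_distrib)
    qed
    ultimately show ?thesis by (simp add: sums_iff)
  qed
  ultimately show ?thesis by simp
qed

subsection \<open>Fourier coefficients of \<open>K\<close>\<close>

lemma e_cis: "e x = cis (2 * pi * x)"
  by (simp add: e_def cis_conv_exp mult.commute)

lemma norm_e [simp]: "cmod (e x) = 1"
  by (simp add: e_cis)

lemma e_add: "e (x + y) = e x * e y"
  by (simp add: e_cis cis_mult algebra_simps)

lemma e_int [simp]: "e (of_int n) = 1"
  by (simp add: e_cis cis_multiple_2pi complex_eq_iff)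

lemma continuous_on_e [continuous_intros]: "continuous_on A f \<Longrightarrow> continuous_on A (\<lambda>x. e (f x))"
  unfolding e_def by (intro continuous_intros)

lemma measurable_e [measurable]: "e \<in> borel_measurable borel"
  by (intro borel_measurable_continuous_onI continuous_intros)

lemma cos_poly_eq:
  "complex_of_real (cos_poly N d x) = (\<Sum>n=-int N..int N. complex_of_real (d (nat \<bar>n\<bar>)) * e (of_int n * x))"
proof (induction N)
  case 0
  show ?case by (simp add: cos_poly_def e_cis)
next
  case (Suc N)
  have s: "{- int (Suc N)..int (Suc N)} = insert (int (Suc N)) (insert (- int (Suc N)) {- int N..int N})" by auto
  have n: "nat \<bar>- int (Suc N)\<bar> = Suc N" "nat \<bar>int (Suc N)\<bar> = Suc N" by auto
  have c: "e (of_int (int (Suc N)) * x) + e (of_int (- int (Suc N)) * x) = complex_of_real (2 * cos (2 * pi * real (Suc N) * x))"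
  proof -
    define t where "t = of_int (int (Suc N)) * x"
    have "of_int (- int (Suc N)) * x = - t" "2 * pi * real (Suc N) * x = 2 * pi * t" by (simp_all add: t_def algebra_simps)
    thus ?thesis unfolding t_def[symmetric] by (simp only:) (simp add: e_cis complex_eq_iff)
  qed
  have "(\<Sum>n=-int (Suc N)..int (Suc N). complex_of_real (d (nat \<bar>n\<bar>)) * e (of_int n * x)) =
    complex_of_real (d (Suc N)) * (e (of_int (int (Suc N)) * x) + e (of_int (- int (Suc N)) * x)) + complex_of_real (cos_poly N d x)"
    unfolding s Suc.IH using n by (subst sum.insert; simp del: of_nat_Suc add: algebra_simps)+
  also have "\<dots> = complex_of_real (cos_poly (Suc N) d x)"
    unfolding c cos_poly_def by (simp add: algebra_simps)
  finally show ?case by simp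
qed

lemma integrable_inverse_quadratic: "integrable lborel (\<lambda>x::real. C * (1 / (1 + x\<^sup>2)))"
proof -
  have "einterval (-\<infinity>) \<infinity> = UNIV" by (auto simp: einterval_iff)
  hence "integrable lborel (\<lambda>x::real. inverse (1 + x\<^sup>2))"
    using integrable_inverse_1_plus_square by (simp add: set_integrable_def)
  thus ?thesis by (intro integrable_mult_right) (simp add: inverse_eq_divide)
qed

section \<open>Unfolding an integral over the line\<close>

lemma indicator_unit_intervals:
  "indicator {- real k..<real k} x = (\<Sum>m\<in>{- int k..<int k}. indicator {of_int m..<of_int m + 1} x :: real)"
proof -
  have *: "indicator {of_int m..<of_int m + 1} x = (if m = \<lfloor>x\<rfloor> then 1 else 0 :: real)" for m :: int
  proof -
    have "x \<in> {of_int m..<of_int m + 1} \<longleftrightarrow> m = \<lfloor>x\<rfloor>" using floor_unique[of m x] by auto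
    thus ?thesis by (simp add: indicator_def)
  qed
  have "x \<in> {- real k..<real k} \<longleftrightarrow> \<lfloor>x\<rfloor> \<in> {- int k..<int k}"
    by (auto simp: le_floor_iff floor_less_iff)
  thus ?thesis unfolding * by (simp add: indicator_def)
qed

lemma set_integral_Ico_Icc:
  fixes f :: "real \<Rightarrow> complex"
  assumes [measurable]: "f \<in> borel_measurable borel"
  shows "(LINT x|lborel. indicator {0..<1} x *\<^sub>R f x) = (LBINT x:{0..1}. f x)"
  unfolding set_lebesgue_integral_def
proof (rule integral_cong_AE)
  show "AE x in lborel. indicator {0..<1} x *\<^sub>R f x = indicator {0..1} x *\<^sub>R f x"
    using AE_lborel_singleton[of "1::real"] by eventually_elim (auto simp: indicator_def)
qed measurable

text \<open>The integrals over [-k, k) are given two limits. By domination they tend to the integral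
  over the line; cut into unit intervals and translated to [0, 1), they tend to the integral of
  \<open>G\<close>, the window sums being bounded by \<open>C * lattice_bound\<close>. An almost
  everywhere limit suits the periodization of \<open>K\<close>, which is computed off the zeros of a
  cosine.\<close>

lemma integral_unfold:
  fixes F G :: "real \<Rightarrow> complex"
  assumes F [measurable]: "F \<in> borel_measurable borel" and G [measurable]: "G \<in> borel_measurable borel"
    and bnd: "\<And>x. cmod (F x) \<le> C * (1 / (1 + x\<^sup>2))" and C: "C \<ge> 0"
    and lim: "AE x in lborel. x \<in> {0..<1} \<longrightarrow> (\<lambda>k. \<Sum>m\<in>{- int k..<int k}. F (x + of_int m)) \<longlonglongrightarrow> G x"
  shows "(LINT x|lborel. F x) = (LBINT x:{0..1}. G x)"
proof -
  have iF: "integrable lborel F"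
    by (rule Bochner_Integration.integrable_bound[OF integrable_inverse_quadratic[of C]])
       (use bnd C in \<open>auto intro!: AE_I2 order_trans[OF bnd] simp: abs_of_nonneg add_nonneg_nonneg\<close>)
  define I where "I k = (LINT x|lborel. indicator {- real k..<real k} x *\<^sub>R F x)" for k
  have "I \<longlonglongrightarrow> (LINT x|lborel. F x)"
    unfolding I_def
  proof (rule integral_dominated_convergence[where w = "\<lambda>x. C * (1 / (1 + x\<^sup>2))"])
    show "AE x in lborel. (\<lambda>k. indicator {- real k..<real k} x *\<^sub>R F x) \<longlonglongrightarrow> F x"
    proof (intro AE_I2 tendsto_eventually)
      fix x :: real
      obtain n where "\<bar>x\<bar> < real n" using reals_Archimedean2 by blast
      thus "\<forall>\<^sub>F k in sequentially. indicator {- real k..<real k} x *\<^sub>R F x = F x"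
        by (intro eventually_mono[OF eventually_ge_at_top[of n]]) (auto simp: indicator_def)
    qed
    show "AE x in lborel. norm (indicator {- real k..<real k} x *\<^sub>R F x) \<le> C * (1 / (1 + x\<^sup>2))" for k
      using bnd C by (intro AE_I2) (auto simp: indicator_def)
  qed (use integrable_inverse_quadratic in auto)
  moreover have "I \<longlonglongrightarrow> (LBINT x:{0..1}. G x)"
  proof -
    have I: "I k = (LINT x|lborel. indicator {0..<1} x *\<^sub>R (\<Sum>m\<in>{- int k..<int k}. F (x + of_int m)))" for k
    proof -
      have int: "integrable lborel (\<lambda>x. indicator {of_int m..<of_int m + 1} x *\<^sub>R F x)" for m :: int
        by (intro integrable_mult_indicator iF) auto
      have aff: "(LINT x|lborel. indicator {of_int m..<of_int m + 1} x *\<^sub>R F x) =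
          (LINT x|lborel. indicator {0..<1} x *\<^sub>R F (x + of_int m))" for m :: int
        by (subst lborel_integral_real_affine[of 1 _ "of_int m"])
           (auto intro!: Bochner_Integration.integral_cong simp: indicator_def add.commute)
      have int': "integrable lborel (\<lambda>x. indicator {0..<1} x *\<^sub>R F (x + of_int m))" for m :: int
      proof (intro integrable_mult_indicator)
        show "integrable lborel (\<lambda>x. F (x + of_int m))"
          using lborel_integrable_real_affine[OF iF, of 1 "of_int m"] by (simp add: add.commute)
      qed auto
      have "I k = (LINT x|lborel. (\<Sum>m\<in>{- int k..<int k}. indicator {of_int m..<of_int m + 1} x *\<^sub>R F x))"
        unfolding I_def indicator_unit_intervals by (simp add: scaleR_sum_left)
      also have "\<dots> = (\<Sum>m\<in>{- int k..<int k}. LINT x|lborel. indicator {0..<1} x *\<^sub>R F (x + of_int m))"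
        by (subst Bochner_Integration.integral_sum[OF int]) (simp add: aff)
      also have "\<dots> = (LINT x|lborel. (\<Sum>m\<in>{- int k..<int k}. indicator {0..<1} x *\<^sub>R F (x + of_int m)))"
        by (rule Bochner_Integration.integral_sum[OF int', symmetric])
      finally show ?thesis by (simp add: scaleR_sum_right)
    qed
    have "I \<longlonglongrightarrow> (LINT x|lborel. indicator {0..<1} x *\<^sub>R G x)"
      unfolding I
    proof (rule integral_dominated_convergence[where w = "\<lambda>x. indicator {0..<1} x *\<^sub>R (C * lattice_bound)"])
      show "AE x in lborel. (\<lambda>k. indicator {0..<1} x *\<^sub>R (\<Sum>m\<in>{- int k..<int k}. F (x + of_int m))) \<longlonglongrightarrow> indicator {0..<1} x *\<^sub>R G x"
        using lim by eventually_elim (auto simp: indicator_def)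
      show "AE x in lborel. norm (indicator {0..<1} x *\<^sub>R (\<Sum>m\<in>{- int k..<int k}. F (x + of_int m))) \<le> indicator {0..<1} x *\<^sub>R (C * lattice_bound)" for k
      proof (rule AE_I2)
        fix x :: real
        have "norm (\<Sum>m\<in>{- int k..<int k}. F (x + of_int m)) \<le> C * lattice_bound" if "x \<in> {0..<1}"
        proof -
          have "norm (\<Sum>m\<in>{- int k..<int k}. F (x + of_int m)) \<le> (\<Sum>m\<in>{- int k..<int k}. C * (1 / (1 + (1 * (x + of_int m))\<^sup>2)))"
            unfolding mult_1 by (rule order_trans[OF norm_sum sum_mono[OF bnd]])
          also have "\<dots> = C * (\<Sum>m\<in>{- int k..<int k}. 1 / (1 + (1 * (x + of_int m))\<^sup>2))"
            by (rule sum_distrib_left[symmetric])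
          also have "\<dots> \<le> C * lattice_bound" using that by (intro mult_left_mono lattice_sum_le C) auto
          finally show ?thesis .
        qed
        thus "norm (indicator {0..<1} x *\<^sub>R (\<Sum>m\<in>{- int k..<int k}. F (x + of_int m))) \<le> indicator {0..<1} x *\<^sub>R (C * lattice_bound)"
          by (auto simp: indicator_def)
      qed
      show "integrable lborel (\<lambda>x::real. indicator {0..<1} x *\<^sub>R (C * lattice_bound))"
        by (intro integrable_mult_indicator integrable_scaleR_left) (auto intro!: integrable_real_indicator)
    qed auto
    thus ?thesis unfolding set_integral_Ico_Icc[OF G] .
  qed
  ultimately show ?thesis by (rule LIMSEQ_unique)
qed

section \<open>Null sets and orthogonality of exponentials\<close>

lemma AE_cos_nonzero:
  assumes "M > 0"
  shows "AE x in lborel. cos (2 * pi * M * x) \<noteq> 0"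
proof -
  have "{x. cos (2 * pi * M * x) = 0} \<subseteq> range (\<lambda>i::int. of_int i / (4 * M))"
  proof
    fix x assume "x \<in> {x. cos (2 * pi * M * x) = 0}"
    then obtain i :: int where "2 * pi * M * x = of_int i * (pi / 2)" by (auto simp: cos_zero_iff_int)
    hence "pi * (x * (4 * M)) = pi * of_int i" by (simp add: algebra_simps)
    hence "x * (4 * M) = of_int i" by simp
    hence "x = of_int i / (4 * M)" using assms by (simp add: field_simps)
    thus "x \<in> range (\<lambda>i::int. of_int i / (4 * M))" by blast
  qed
  hence "countable {x. cos (2 * pi * M * x) = 0}" by (rule countable_subset) auto
  from AE_not_in[OF countable_imp_null_set_lborel[OF this]] show ?thesis by simp
qed

lemma exp_integral:
  fixes c :: complex
  assumes "c \<noteq> 0" "a \<le> b"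
  shows "has_bochner_integral lborel (\<lambda>x. indicator {a..b} x *\<^sub>R exp (c * of_real x)) ((exp (c * of_real b) - exp (c * of_real a)) / c)"
proof -
  have "has_bochner_integral lborel (\<lambda>x. indicator {a..b} x *\<^sub>R exp (c * of_real x)) (exp (c * of_real b) / c - exp (c * of_real a) / c)"
  proof (rule has_bochner_integral_FTC_Icc[OF assms(2)])
    fix x
    have "((\<lambda>z. exp (c * z) / c) has_field_derivative exp (c * of_real x)) (at (of_real x))"
      using assms(1) by (auto intro!: derivative_eq_intros)
    hence "((\<lambda>x. exp (c * of_real x) / c) has_vector_derivative exp (c * of_real x)) (at x)"
      by (rule has_vector_derivative_real_field)
    thus "((\<lambda>x. exp (c * of_real x) / c) has_vector_derivative exp (c * of_real x)) (at x within {a..b})"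
      by (rule has_vector_derivative_at_within)
  qed (intro continuous_intros)
  thus ?thesis by (simp add: diff_divide_distrib)
qed

lemma e_exp: "e (of_int n * x) = exp (of_real (2 * pi * of_int n) * \<i> * of_real x)"
  by (simp add: e_def mult_ac)

lemma integral_e:
  "has_bochner_integral lborel (\<lambda>x. indicator {0..1} x *\<^sub>R e (of_int n * x)) (if n = 0 then 1 else 0)"
proof (cases "n = 0")
  case True
  have "has_bochner_integral lborel (indicator {0..1::real}) (measure lborel {0..1::real})"
    by (intro has_bochner_integral_real_indicator) auto
  hence "has_bochner_integral lborel (\<lambda>x. complex_of_real (indicator {0..1::real} x)) (complex_of_real 1)"
    by (intro has_bochner_integral_of_real) simp
  thus ?thesis using True by (simp add: e_cis scaleR_conv_of_real)
next
  case False
  hence "complex_of_real (2 * pi * of_int n) * \<i> \<noteq> 0" by simp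
  note * = exp_integral[OF this, of 0 1]
  have "exp (complex_of_real (2 * pi * of_int n) * \<i> * complex_of_real 1) = 1"
    using e_exp[of n 1] e_int[of n] by simp
  thus ?thesis using * False unfolding e_exp by (simp only:) simp
qed

lemma integral_trig_coeff:
  assumes "j \<in> {- int N..int N}"
  shows "(LBINT x:{0..1}. (\<Sum>n=-int N..int N. c n * e (of_int n * x)) * e (- of_int j * x)) = c j"
proof -
  have "has_bochner_integral lborel (\<lambda>x. \<Sum>n=-int N..int N. c n * (indicator {0..1} x *\<^sub>R e (of_int (n - j) * x)))
     (\<Sum>n=-int N..int N. c n * (if n - j = 0 then 1 else 0))"
    by (intro has_bochner_integral_sum has_bochner_integral_mult_right integral_e)
  also have "(\<lambda>x. \<Sum>n=-int N..int N. c n * (indicator {0..1} x *\<^sub>R e (of_int (n - j) * x))) =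
     (\<lambda>x. indicator {0..1} x *\<^sub>R ((\<Sum>n=-int N..int N. c n * e (of_int n * x)) * e (- of_int j * x)))"
  proof
    fix x
    have "e (of_int (n - j) * x) = e (of_int n * x) * e (- of_int j * x)" for n
      by (simp add: e_add[symmetric] algebra_simps)
    thus "(\<Sum>n=-int N..int N. c n * (indicator {0..1} x *\<^sub>R e (of_int (n - j) * x))) =
      indicator {0..1} x *\<^sub>R ((\<Sum>n=-int N..int N. c n * e (of_int n * x)) * e (- of_int j * x))"
      by (simp add: sum_distrib_right scaleR_sum_right mult.assoc)
  qed
  also have "(\<Sum>n=-int N..int N. c n * (if n - j = 0 then 1 else 0)) = c j"
    using assms by (simp add: if_distrib[of "\<lambda>t. c _ * t"] cong: if_cong)
  finally show ?thesis unfolding set_lebesgue_integral_def by (rule has_bochner_integral_integral_eq)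
qed

lemma K_fun_measurable [measurable]:
  assumes "r > 0" shows "K_fun r \<in> borel_measurable borel"
proof -
  have "K_fun r = (\<lambda>z. \<Sum>n. (-1) ^ n * (cos (pi * z) / pi * pole_pair z n) * exp (- r * half n))"
    using K_fun_sums[OF assms] by (auto simp: sums_iff)
  thus ?thesis unfolding pole_pair_def by simp
qed

text \<open>Rescaling by 2 M turns the frequency j / (2 M) into the integer j, so that e(-j x) is
  unchanged by x -> x + m. Unfolding then gives the j-th Fourier coefficient of the periodized
  kernel; the factor 2 M is the Jacobian.\<close>

lemma K_hat_eq:
  assumes M: "M = real (Suc N)" and r: "r > 0" and j: "j \<in> {- int N..int N}"
  shows "K_hat r (of_int j / (2 * M)) = of_real (2 * M * interp_coeff N r (nat \<bar>j\<bar>))"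
proof -
  have Mp: "M \<ge> 1" by (simp add: M)
  define F where "F x = complex_of_real (K_fun r (2 * M * x)) * e (- of_int j * x)" for x
  define G where "G x = complex_of_real (cos_poly N (interp_coeff N r) x) * e (- of_int j * x)" for x
  have "K_hat r (of_int j / (2 * M)) = \<bar>2 * M\<bar> *\<^sub>R (LINT x|lborel. complex_of_real (K_fun r (0 + 2 * M * x)) * e (- (of_int j / (2 * M)) * (0 + 2 * M * x)))"
    unfolding K_hat_def using Mp by (intro lborel_integral_real_affine) auto
  also have "\<dots> = of_real (2 * M) * (LINT x|lborel. F x)"
    using Mp by (simp add: F_def scaleR_conv_of_real)
  also have "(LINT x|lborel. F x) = (LBINT x:{0..1}. G x)"
  proof (rule integral_unfold)
    show "F \<in> borel_measurable borel" unfolding F_def using K_fun_measurable[OF r] by measurable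
    show "G \<in> borel_measurable borel" unfolding G_def cos_poly_def by measurable
    show "suminf (K_majorant r) \<ge> 0" by (rule suminf_K_majorant_nonneg[OF r])
    fix x
    have "cmod (F x) = \<bar>K_fun r (2 * M * x)\<bar>" by (simp add: F_def norm_mult)
    also have "\<dots> \<le> suminf (K_majorant r) * (1 / (1 + (2 * M * x)\<^sup>2))" by (rule K_fun_bound[OF r])
    also have "\<dots> \<le> suminf (K_majorant r) * (1 / (1 + x\<^sup>2))"
    proof (intro mult_left_mono suminf_K_majorant_nonneg[OF r] divide_left_mono)
      have "\<bar>x\<bar> \<le> \<bar>2 * M * x\<bar>" using Mp mult_right_mono[of 1 "2 * M" "\<bar>x\<bar>"] by (simp add: abs_mult)
      thus "1 + x\<^sup>2 \<le> 1 + (2 * M * x)\<^sup>2" by (simp add: abs_le_square_iff)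
    qed (auto simp: add_pos_nonneg intro!: mult_pos_pos)
    finally show "cmod (F x) \<le> suminf (K_majorant r) * (1 / (1 + x\<^sup>2))" .
  next
    have "M > 0" using Mp by simp
    from AE_cos_nonzero[OF this]
    show "AE x in lborel. x \<in> {0..<1} \<longrightarrow> (\<lambda>k. \<Sum>m\<in>{- int k..<int k}. F (x + of_int m)) \<longlonglongrightarrow> G x"
    proof (eventually_elim, intro impI)
      fix x assume x: "cos (2 * pi * M * x) \<noteq> 0" "x \<in> {0..<1}"
      have "e (- of_int j * (x + of_int m)) = e (- of_int j * x)" for m :: int
        using e_add[of "- of_int j * x" "of_int (- j * m)"] e_int[of "- j * m"] by (simp add: algebra_simps)
      hence "(\<lambda>k. \<Sum>m\<in>{- int k..<int k}. F (x + of_int m)) = 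
        (\<lambda>k. complex_of_real (\<Sum>m\<in>{- int k..<int k}. K_fun r (2 * M * (x + of_int m))) * e (- of_int j * x))"
        by (simp only: F_def sum_distrib_right of_real_sum)
      also have "\<dots> \<longlonglongrightarrow> G x" unfolding G_def
        using x by (intro tendsto_intros K_periodization M r) auto
      finally show "(\<lambda>k. \<Sum>m\<in>{- int k..<int k}. F (x + of_int m)) \<longlonglongrightarrow> G x" .
    qed
  qed
  also have "(LBINT x:{0..1}. G x) = complex_of_real (interp_coeff N r (nat \<bar>j\<bar>))"
    unfolding G_def cos_poly_eq by (rule integral_trig_coeff[OF j])
  finally show ?thesis by simp
qed

text \<open>The Jacobian from \<open>K_hat_eq\<close> cancels the normalization of
  \<open>k_fun\<close>, and what remains is real.\<close>

lemma k_fun_eq: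
  assumes "lam > 0"
  shows "k_fun lam N x = complex_of_real (- 2 / lam + cos_poly N (interp_coeff N (lam / (2 * real N + 2))) x)"
proof -
  have M: "2 * real N + 2 = 2 * real (Suc N)" by simp
  have r: "lam / (2 * real N + 2) > 0" using assms by (simp add: add_nonneg_pos)
  have nz: "complex_of_real (2 * real (Suc N)) \<noteq> 0" unfolding of_real_eq_0_iff by simp
  have "k_fun lam N x = complex_of_real (- 2 / lam) + (1 / (2 * of_nat N + 2)) *
     (\<Sum>n = - int N..int N. of_real (2 * real (Suc N)) * (of_real (interp_coeff N (lam / (2 * real N + 2)) (nat \<bar>n\<bar>)) * e (of_int n * x)))"
  proof -
    have "K_hat (lam / (2 * real N + 2)) (of_int n / (2 * real N + 2)) * e (of_int n * x) =
       of_real (2 * real (Suc N)) * (of_real (interp_coeff N (lam / (2 * real N + 2)) (nat \<bar>n\<bar>)) * e (of_int n * x))"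
      if "n \<in> {- int N..int N}" for n
      using K_hat_eq[OF refl r that, folded M] by (simp only: M of_real_mult mult.assoc)
    hence "(\<Sum>n = - int N..int N. K_hat (lam / (2 * real N + 2)) (of_int n / (2 * real N + 2)) * e (of_int n * x)) =
       (\<Sum>n = - int N..int N. of_real (2 * real (Suc N)) * (of_real (interp_coeff N (lam / (2 * real N + 2)) (nat \<bar>n\<bar>)) * e (of_int n * x)))"
      by (intro sum.cong refl)
    thus ?thesis unfolding k_fun_def by (simp only:)
  qed
  also have "\<dots> = complex_of_real (- 2 / lam) + (1 / (2 * of_nat N + 2) * of_real (2 * real (Suc N))) *
     complex_of_real (cos_poly N (interp_coeff N (lam / (2 * real N + 2))) x)"
    unfolding cos_poly_eq sum_distrib_left[symmetric] by (simp only: mult.assoc)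
  also have "1 / (2 * of_nat N + 2) * complex_of_real (2 * real (Suc N)) = 1"
    using nz by (simp add: algebra_simps)
  finally show ?thesis by simp
qed

subsection \<open>The sign of the error\<close>

text \<open>For positive \<open>lam\<close> this is cosh(lam (x - 1/2)) / sinh(lam / 2). It
  represents the periodic sum on [0, 1] only and is not itself periodic.\<close>

definition exp_periodization :: "real \<Rightarrow> real \<Rightarrow> real" where
  "exp_periodization lam x = (exp (- lam * x) + exp (- lam * (1 - x))) / (1 - exp (- lam))"

text \<open>Two geometric series, over m >= 0 and over m < 0. The unconditional sum evaluates
  \<open>p_fun\<close>; the window limit is what is compared with
  \<open>K_periodization\<close>.\<close>

lemma p_fun_has_sum:
  assumes "lam > 0" "0 \<le> x" "x < 1"
  shows "((\<lambda>m::int. exp (- lam * \<bar>x + of_int m\<bar>)) has_sum exp_periodization lam x) UNIV" (is ?A)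
    and "(\<lambda>k. \<Sum>m\<in>{- int k..<int k}. exp (- lam * \<bar>x + of_int m\<bar>)) \<longlonglongrightarrow> exp_periodization lam x" (is ?B)
proof -
  define f where "f m = exp (- lam * \<bar>x + of_int m\<bar>)" for m :: int
  have fp: "f (int n) = exp (- lam * x) * exp (- lam) ^ n" for n
    unfolding f_def exp_of_nat_mult[symmetric] exp_add[symmetric] using assms by (simp add: algebra_simps)
  have fm: "f (- int n - 1) = exp (- lam * (1 - x)) * exp (- lam) ^ n" for n
    unfolding f_def exp_of_nat_mult[symmetric] exp_add[symmetric] using assms by (simp add: algebra_simps)
  have g: "(\<lambda>n. exp (- lam) ^ n) sums (1 / (1 - exp (- lam)))"
    by (rule geometric_sums) (use assms in simp)
  have sp: "(\<lambda>n. f (int n)) sums (exp (- lam * x) * (1 / (1 - exp (- lam))))"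
    unfolding fp by (rule sums_mult[OF g])
  have sm: "(\<lambda>n. f (- int n - 1)) sums (exp (- lam * (1 - x)) * (1 / (1 - exp (- lam))))"
    unfolding fm by (rule sums_mult[OF g])
  have e: "exp_periodization lam x = exp (- lam * x) * (1 / (1 - exp (- lam))) + exp (- lam * (1 - x)) * (1 / (1 - exp (- lam)))"
    by (simp add: exp_periodization_def add_divide_distrib)
  have "(f has_sum exp_periodization lam x) UNIV"
    unfolding e by (intro has_sum_int_split sums_nonneg_imp_has_sum sp sm) (auto simp: f_def)
  thus ?A by (simp add: f_def[abs_def])
  show ?B unfolding f_def[symmetric] sum_int_symmetric e using sums_add[OF sp sm] by (simp add: sums_def)
qed

lemma p_fun_periodic: "p_fun lam (x + of_int k) = p_fun lam x"
proof -
  have "(\<Sum>\<^sub>\<infinity>m::int. exp (- lam * \<bar>x + of_int k + of_int m\<bar>)) = (\<Sum>\<^sub>\<infinity>m::int. exp (- lam * \<bar>x + of_int m\<bar>))"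
    by (rule infsum_reindex_bij_witness[of _ "\<lambda>m. m - k" "\<lambda>m. m + k"]) (auto simp: algebra_simps)
  thus ?thesis by (simp add: p_fun_def)
qed

lemma p_fun_eq:
  assumes "lam > 0" "0 \<le> x" "x \<le> 1"
  shows "p_fun lam x = - 2 / lam + exp_periodization lam x"
proof (cases "x = 1")
  case True
  have "p_fun lam 1 = p_fun lam 0" using p_fun_periodic[of lam 0 1] by simp
  also have "\<dots> = - 2 / lam + exp_periodization lam 0" using infsumI[OF p_fun_has_sum(1)[of lam 0]] assms by (simp add: p_fun_def)
  also have "exp_periodization lam 0 = exp_periodization lam 1" by (simp add: exp_periodization_def)
  finally show ?thesis using True by simp
next
  case False
  thus ?thesis using infsumI[OF p_fun_has_sum(1)[of lam x]] assms by (simp add: p_fun_def)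
qed

text \<open>On the lattice the error is termwise C q(m), with C = cos(2 pi M x) common to all m and
  q(m) > 0 by \<open>interpolation_error_pos\<close>. The factor \<open>Q\<close> is the limit of
  the window sums of q.\<close>

lemma error_factor:
  assumes lam: "lam > 0" and M: "M = real (Suc N)" and x: "cos (2 * pi * M * x) \<noteq> 0" "0 \<le> x" "x < 1"
  obtains Q where "Q > 0" "exp_periodization lam x - cos_poly N (interp_coeff N (lam / (2 * M))) x = cos (2 * pi * M * x) * Q"
proof -
  define r where "r = lam / (2 * M)"
  define C where "C = cos (2 * pi * M * x)"
  define z where "z m = 2 * M * (x + of_int m)" for m :: int
  define q where "q m = (pi * exp (- r * \<bar>z m\<bar>) / C - alt_dirichlet (pole_pair (z m)) r) / pi" for m
  define L where "L = exp_periodization lam x - cos_poly N (interp_coeff N r) x"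
  have Mp: "M > 0" by (simp add: M)
  have r: "r > 0" using lam Mp by (simp add: r_def)
  have C: "C \<noteq> 0" using x by (simp add: C_def)
  have cz: "cos (pi * z m) = C" for m unfolding z_def C_def by (rule cos_shift_int[OF M])
  have cza: "cos (pi * \<bar>z m\<bar>) = C" for m using cz[of m] by (cases "z m \<ge> 0") auto
  have q: "q m > 0" for m
  proof -
    \<comment> \<open>Evenness of \<open>pole_pair\<close> and of the cosine carries
      \<open>interpolation_error_pos\<close> from nonnegative to negative points.\<close>
    have "pole_pair \<bar>z m\<bar> = pole_pair (z m)" by (simp add: pole_pair_def fun_eq_iff)
    moreover have "pi * exp (- r * \<bar>z m\<bar>) / cos (pi * \<bar>z m\<bar>) - alt_dirichlet (pole_pair \<bar>z m\<bar>) r > 0"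
      using interpolation_error_pos[of "\<bar>z m\<bar>" r] C r unfolding cza by simp
    ultimately show ?thesis unfolding q_def cza by simp
  qed
  have trm: "exp (- lam * \<bar>x + of_int m\<bar>) - K_fun r (z m) = C * q m" for m
  proof -
    have "lam * \<bar>x + of_int m\<bar> = r * \<bar>z m\<bar>" using Mp by (simp add: r_def z_def abs_mult)
    hence E: "exp (- lam * \<bar>x + of_int m\<bar>) = exp (- r * \<bar>z m\<bar>)" by simp
    show ?thesis using C unfolding K_fun_eq[OF r] cz q_def E by (simp add: diff_divide_distrib right_diff_distrib)
  qed
  have "(\<lambda>k. (\<Sum>m\<in>{- int k..<int k}. exp (- lam * \<bar>x + of_int m\<bar>)) - (\<Sum>m\<in>{- int k..<int k}. K_fun r (z m))) \<longlonglongrightarrow> L"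
    unfolding L_def z_def using x by (intro tendsto_diff p_fun_has_sum(2) K_periodization M lam r) auto
  hence "(\<lambda>k. C * (\<Sum>m\<in>{- int k..<int k}. q m)) \<longlonglongrightarrow> L"
    unfolding sum_subtractf[symmetric] trm sum_distrib_left .
  hence "(\<lambda>k. C * (\<Sum>m\<in>{- int k..<int k}. q m) / C) \<longlonglongrightarrow> L / C" by (intro tendsto_divide tendsto_const C)
  hence "(\<lambda>k. \<Sum>m\<in>{- int k..<int k}. q m) \<longlonglongrightarrow> L / C" using C by simp
  \<comment> \<open>A limit of positive sums could be 0; the single term \<open>q 0\<close> as a
    lower bound keeps it strictly positive.\<close>
  moreover have "\<forall>\<^sub>F k in sequentially. (\<Sum>m\<in>{- int k..<int k}. q m) \<ge> q 0"
    using eventually_gt_at_top[of 0]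
  proof eventually_elim
    case (elim k)
    show ?case using elim less_imp_le[OF q] by (intro member_le_sum) auto
  qed
  ultimately have "L / C \<ge> q 0" by (intro tendsto_lowerbound) auto
  hence LC: "L / C > 0" using q[of 0] by simp
  have "exp_periodization lam x - cos_poly N (interp_coeff N (lam / (2 * M))) x = cos (2 * pi * M * x) * (L / C)"
    unfolding C_def[symmetric] r_def[symmetric] L_def using C by simp
  thus ?thesis by (rule that[OF LC])
qed

section \<open>The square wave and its sign changes\<close>

definition square_wave :: "real \<Rightarrow> real \<Rightarrow> real" where "square_wave M x = sgn (cos (2 * pi * M * x))"

lemma square_wave_measurable [measurable]: "square_wave M \<in> borel_measurable borel"
  unfolding square_wave_def[abs_def] sgn_real_def by measurable

lemma square_wave_bound: "\<bar>square_wave M x\<bar> \<le> 1" by (auto simp: square_wave_def sgn_real_def)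

text \<open>Arbitrarily close to x0 on its two sides, f takes real values of opposite sign or 0, and
  continuity forces f x0 = 0. This serves both the error of \<open>k_fun\<close> and that of an
  extremal polynomial, whose sign is known only almost everywhere.\<close>

lemma sign_change_zero:
  fixes f :: "real \<Rightarrow> complex"
  assumes M: "M > 0" and f: "continuous_on {0..1} f" and x0: "0 < x0" "x0 < 1" "cos (2 * pi * M * x0) = 0"
    and dense: "\<And>a b. 0 \<le> a \<Longrightarrow> a < b \<Longrightarrow> b \<le> 1 \<Longrightarrow> \<exists>x. a < x \<and> x < b \<and> f x = of_real (cmod (f x) * square_wave M x)"
  shows "f x0 = 0"
proof (rule ccontr)
  assume "f x0 \<noteq> 0"
  define \<epsilon> where "\<epsilon> = cmod (f x0)"
  have ep: "\<epsilon> > 0" using \<open>f x0 \<noteq> 0\<close> by (simp add: \<epsilon>_def)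
  from f[unfolded continuous_on_iff, rule_format, of x0 "\<epsilon>/2"] x0 ep
  obtain \<delta> where d: "\<delta> > 0" "\<And>x. x \<in> {0..1} \<Longrightarrow> dist x x0 < \<delta> \<Longrightarrow> dist (f x) (f x0) < \<epsilon> / 2" by auto
  define s where "s = sin (2 * pi * M * x0)"
  have "s\<^sup>2 = 1" using sin_cos_squared_add[of "2 * pi * M * x0"] x0 by (simp add: s_def)
  hence s: "s = 1 \<or> s = -1" by (simp add: power2_eq_1_iff)
  have c: "cos (2 * pi * M * (x0 + t)) = - s * sin (2 * pi * M * t)" for t
    using x0(3) by (simp add: distrib_left cos_add s_def)
  have sp: "sin (2 * pi * M * t) > 0" if "0 < t" "t < 1 / (2 * M)" for t
  proof (rule sin_gt_zero)
    show "0 < 2 * pi * M * t" using that M by simp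
    have "2 * M * t < 1" using that M by (simp add: field_simps)
    hence "pi * (2 * M * t) < pi * 1" by (intro mult_strict_left_mono) auto
    thus "2 * pi * M * t < pi" by (simp add: mult_ac)
  qed
  \<comment> \<open>Within 1 / (2 M) of x0 the cosine has no other zero; the remaining bounds keep
    the points close to x0 and in [0, 1].\<close>
  define \<eta> where "\<eta> = min (min \<delta> (1 / (2 * M))) (min x0 (1 - x0))"
  have \<eta>: "\<eta> > 0" "\<eta> \<le> \<delta>" "\<eta> \<le> 1 / (2 * M)" "\<eta> \<le> x0" "\<eta> \<le> 1 - x0" using d x0 M by (auto simp: \<eta>_def)
  obtain x1 where x1: "x0 - \<eta> < x1" "x1 < x0" "f x1 = of_real (cmod (f x1) * square_wave M x1)"
    using dense[of "x0 - \<eta>" x0] \<eta> x0 by auto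
  obtain x2 where x2: "x0 < x2" "x2 < x0 + \<eta>" "f x2 = of_real (cmod (f x2) * square_wave M x2)"
    using dense[of x0 "x0 + \<eta>"] \<eta> x0 by auto
  have s1: "square_wave M x1 = s"
  proof -
    have "2 * pi * M * (x1 - x0) = - (2 * pi * M * (x0 - x1))" by (simp add: algebra_simps)
    hence "cos (2 * pi * M * x1) = s * sin (2 * pi * M * (x0 - x1))"
      using c[of "x1 - x0"] by (simp only: sin_minus) simp
    thus ?thesis using sp[of "x0 - x1"] x1 \<eta> s by (auto simp: square_wave_def sgn_mult)
  qed
  have s2: "square_wave M x2 = - s"
    using c[of "x2 - x0"] sp[of "x2 - x0"] x2 \<eta> s by (auto simp: square_wave_def sgn_mult)
  have d1: "dist (f x1) (f x0) < \<epsilon> / 2" "dist (f x2) (f x0) < \<epsilon> / 2"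
    by (rule d(2); use x1(1,2) x2(1,2) \<eta> x0(1,2) in \<open>auto simp: dist_real_def\<close>)+
  have n: "cmod (f x0) \<le> cmod (f x1) + dist (f x1) (f x0)" "cmod (f x0) \<le> cmod (f x2) + dist (f x2) (f x0)"
    using norm_triangle_ineq2[of "f x0" "f x1"] norm_triangle_ineq2[of "f x0" "f x2"] by (auto simp: dist_norm norm_minus_commute)
  \<comment> \<open>Opposite signs make the distance of the two values the sum of their moduli.
    Closeness to f x0 makes that sum exceed \<epsilon> and the distance fall below
    \<epsilon>.\<close>
  have "f x1 - f x2 = of_real (s * (cmod (f x1) + cmod (f x2)))"
    by (subst x1(3), subst x2(3)) (simp add: s1 s2 algebra_simps)
  hence "dist (f x1) (f x2) = \<bar>s * (cmod (f x1) + cmod (f x2))\<bar>" unfolding dist_norm by (simp only: norm_of_real)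
  moreover have "\<bar>s\<bar> = 1" using s by auto
  ultimately have "dist (f x1) (f x2) = cmod (f x1) + cmod (f x2)" by (simp only: abs_mult) simp
  moreover have "dist (f x1) (f x2) \<le> dist (f x1) (f x0) + dist (f x2) (f x0)" by (rule dist_triangle2)
  ultimately show False using n d1 by (simp add: \<epsilon>_def)
qed

lemma continuous_on_cos_poly: "continuous_on A (cos_poly N d)"
  unfolding cos_poly_def[abs_def] by (intro continuous_intros)

lemma continuous_on_exp_periodization: "lam > 0 \<Longrightarrow> continuous_on A (exp_periodization lam)"
  unfolding exp_periodization_def[abs_def] by (intro continuous_intros) auto

text \<open>A nonempty open interval has positive measure, so it cannot consist of exceptional
  points.\<close>

lemma AE_imp_dense:
  assumes "AE x in lborel. x \<in> {0..1::real} \<longrightarrow> P x" "0 \<le> a" "a < b" "b \<le> 1"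
  shows "\<exists>x. a < x \<and> x < b \<and> P x"
proof (rule ccontr)
  assume H: "\<not> ?thesis"
  from assms(1) have "AE x in lborel. x \<notin> {a<..<b}" by eventually_elim (use H assms in auto)
  hence "{a<..<b} \<in> null_sets lborel" by (subst AE_iff_null_sets) auto
  hence "emeasure lborel {a<..<b} = 0" by auto
  thus False using assms by simp
qed

lemma error_square_wave:
  assumes lam: "lam > 0" and M: "M = real (Suc N)" and x: "cos (2 * pi * M * x) \<noteq> 0" "0 \<le> x" "x < 1"
  shows "exp_periodization lam x - cos_poly N (interp_coeff N (lam / (2 * M))) x = \<bar>exp_periodization lam x - cos_poly N (interp_coeff N (lam / (2 * M))) x\<bar> * square_wave M x"
    and "sgn (exp_periodization lam x - cos_poly N (interp_coeff N (lam / (2 * M))) x) = square_wave M x"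
proof -
  obtain Q where Q: "Q > 0" "exp_periodization lam x - cos_poly N (interp_coeff N (lam / (2 * M))) x = cos (2 * pi * M * x) * Q"
    using error_factor[OF assms] .
  show "sgn (exp_periodization lam x - cos_poly N (interp_coeff N (lam / (2 * M))) x) = square_wave M x"
    unfolding Q(2) using Q(1) by (simp add: square_wave_def sgn_mult)
  show "exp_periodization lam x - cos_poly N (interp_coeff N (lam / (2 * M))) x = \<bar>exp_periodization lam x - cos_poly N (interp_coeff N (lam / (2 * M))) x\<bar> * square_wave M x"
    unfolding Q(2) using Q(1) by (simp add: square_wave_def abs_mult) (simp add: sgn_real_def)
qed

text \<open>At a zero of the cosine the factorization of \<open>error_factor\<close> does not apply;
  equality follows by continuity from the sign change of the error.\<close>

lemma error_node:
  assumes lam: "lam > 0" and M: "M = real (Suc N)" and x: "cos (2 * pi * M * x) = 0" "0 \<le> x" "x < 1"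
  shows "exp_periodization lam x = cos_poly N (interp_coeff N (lam / (2 * M))) x"
proof -
  define f where "f x = complex_of_real (exp_periodization lam x - cos_poly N (interp_coeff N (lam / (2 * M))) x)" for x
  have Mp: "M > 0" by (simp add: M)
  \<comment> \<open>Since cos 0 = 1, the node is not the left endpoint and has neighbours in [0, 1]
    on both sides.\<close>
  have "x \<noteq> 0" using x(1) by auto
  have "f x = 0"
  proof (rule sign_change_zero[OF Mp _ _ x(3,1)])
    show "continuous_on {0..1} f" unfolding f_def
      by (intro continuous_intros continuous_on_cos_poly[unfolded o_def] continuous_on_exp_periodization lam)
    show "0 < x" using \<open>x \<noteq> 0\<close> x by simp
    fix a b :: real assume ab: "0 \<le> a" "a < b" "b \<le> 1"
    have "AE x in lborel. x \<in> {0..1} \<longrightarrow> cos (2 * pi * M * x) \<noteq> 0"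
      using AE_cos_nonzero[OF Mp] by eventually_elim auto
    from AE_imp_dense[OF this ab] obtain y where y: "a < y" "y < b" "cos (2 * pi * M * y) \<noteq> 0" by auto
    have "f y = of_real (cmod (f y) * square_wave M y)"
      using error_square_wave(1)[OF lam M y(3)] y ab unfolding f_def norm_of_real by simp
    thus "\<exists>x. a < x \<and> x < b \<and> f x = of_real (cmod (f x) * square_wave M x)" using y by blast
  qed
  thus ?thesis by (simp add: f_def)
qed

text \<open>All functions involved have period 1, which reduces the claim to the fractional part of
  x, where the closed form \<open>exp_periodization\<close> is valid.\<close>

lemma sgn_error:
  assumes lam: "lam > 0"
  shows "sgn (complex_of_real (cos (pi * (2 * real N + 2) * x))) = sgn (complex_of_real (p_fun lam x) - k_fun lam N x)"
proof -
  define M where "M = real (Suc N)"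
  have MM: "2 * M = 2 * real N + 2" by (simp add: M_def)
  define y where "y = frac x"
  have xy: "x = y + of_int \<lfloor>x\<rfloor>" by (simp add: y_def frac_def)
  have y: "0 \<le> y" "y < 1" by (auto simp: y_def frac_lt_1)
  have c: "cos (pi * (2 * real N + 2) * x) = cos (2 * pi * M * y)"
    using cos_shift_int[OF M_def, of y "\<lfloor>x\<rfloor>"] unfolding xy[symmetric] MM[symmetric] by (simp add: mult_ac)
  have p: "p_fun lam x = - 2 / lam + exp_periodization lam y"
    using p_fun_periodic[of lam y "\<lfloor>x\<rfloor>"] p_fun_eq[OF lam y(1)] y(2) unfolding xy[symmetric] by simp
  have en: "e (of_int n * x) = e (of_int n * y)" for n
  proof -
    have "of_int n * x = of_int n * y + of_int (n * \<lfloor>x\<rfloor>)" by (subst xy) (simp add: distrib_left)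
    thus ?thesis by (simp only: e_add e_int mult_1_right)
  qed
  have "k_fun lam N x = k_fun lam N y" unfolding k_fun_def en ..
  hence k: "k_fun lam N x = complex_of_real (- 2 / lam + cos_poly N (interp_coeff N (lam / (2 * M))) y)"
    unfolding MM by (simp only: k_fun_eq[OF lam])
  have pk: "complex_of_real (p_fun lam x) - k_fun lam N x = complex_of_real (exp_periodization lam y - cos_poly N (interp_coeff N (lam / (2 * M))) y)"
    unfolding p k by simp
  show ?thesis
  proof (cases "cos (2 * pi * M * y) = 0")
    case True
    thus ?thesis unfolding c pk using error_node[OF lam M_def True y] by simp
  next
    case False
    thus ?thesis unfolding c pk sgn_of_real using error_square_wave(2)[OF lam M_def False y] by (simp add: square_wave_def)
  qed
qed

subsection \<open>The square wave and the extremal problem\<close>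

lemma square_wave_shift_half:
  assumes "M > 0" shows "square_wave M (x + 1 / (2 * M)) = - square_wave M x"
proof -
  have "2 * pi * M * (x + 1 / (2 * M)) = 2 * pi * M * x + pi" using assms by (simp add: field_simps)
  thus ?thesis by (simp add: square_wave_def sgn_minus)
qed

lemma square_wave_shift_one:
  assumes "M = real (Suc N)" shows "square_wave M (x + 1) = square_wave M x"
  using cos_shift_int[OF assms, of x 1] by (simp add: square_wave_def mult_ac)

lemma square_wave_exp_integrable:
  "integrable lborel (\<lambda>x. indicator {a..<b} x *\<^sub>R (exp (c * complex_of_real x) * of_real (square_wave M x)))"
proof (rule Bochner_Integration.integrable_bound)
  show "integrable lborel (\<lambda>x. indicator {a..b} x *\<^sub>R exp (c * complex_of_real x))"
    by (intro borel_integrable_compact continuous_intros) auto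
  show "AE x in lborel. norm (indicator {a..<b} x *\<^sub>R (exp (c * complex_of_real x) * of_real (square_wave M x))) \<le>
      norm (indicator {a..b} x *\<^sub>R exp (c * complex_of_real x))"
    using square_wave_bound[of M] by (intro AE_I2) (auto simp: indicator_def norm_mult mult_left_le)
qed measurable

text \<open>Over a period the integrand is antiperiodic up to the factor \<open>exp (c / (2 M))\<close>; comparing the integral over \<open>[0, 1]\<close>
  with that over the interval shifted by half a wavelength avoids any decomposition into cells.\<close>

lemma square_wave_exp_integral:
  assumes M: "M = real (Suc N)"
  shows "(LBINT x:{0..1}. exp (c * complex_of_real x) * of_real (square_wave M x)) * (1 + exp (c / of_real (2 * M))) =
      (LINT x|lborel. indicator {0..<1 / (2 * M)} x *\<^sub>R (exp (c * complex_of_real x) * of_real (square_wave M x))) * (1 - exp c)"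
proof -
  define g where "g x = exp (c * complex_of_real x) * of_real (square_wave M x)" for x
  define I where "I a b = (LINT x|lborel. indicator {a..<b} x *\<^sub>R g x)" for a b :: real
  define h where "h = 1 / (2 * M)"
  have h: "0 < h" "h < 1" by (auto simp: h_def M field_simps)
  have int: "integrable lborel (\<lambda>x. indicator {a..<b} x *\<^sub>R g x)" for a b
    unfolding g_def by (rule square_wave_exp_integrable)
  have add: "I a b + I b d = I a d" if "a \<le> b" "b \<le> d" for a b d
    unfolding I_def Bochner_Integration.integral_add[OF int int, symmetric]
    using that by (intro Bochner_Integration.integral_cong) (auto simp: indicator_def)
  have shift: "I (a + t) (b + t) = u * I a b" if "\<And>x. g (x + t) = u * g x" for a b t u
  proof -
    have "I (a + t) (b + t) = (LINT x|lborel. u * (indicator {a..<b} x *\<^sub>R g x))"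
      unfolding I_def
      by (subst lborel_integral_real_affine[of 1 _ t])
         (auto intro!: Bochner_Integration.integral_cong simp: indicator_def add.commute[of t] that)
    also have "\<dots> = u * I a b" unfolding I_def by (rule integral_mult_right_zero)
    finally show ?thesis .
  qed
  have gh: "g (x + h) = - exp (c * of_real h) * g x" for x
    unfolding g_def h_def using square_wave_shift_half[of M x] by (simp add: M distrib_left exp_add del: of_nat_Suc)
  have g1: "g (x + 1) = exp c * g x" for x
    unfolding g_def using square_wave_shift_one[OF M, of x] by (simp add: distrib_left exp_add)
  have "I 0 h + I h (1 + h) = I 0 1 + I 1 (1 + h)" using add[of 0 h "1 + h"] add[of 0 1 "1 + h"] h by simp
  moreover have "I h (1 + h) = - exp (c * of_real h) * I 0 1" using shift[OF gh, of 0 1] by simp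
  moreover have "I 1 (1 + h) = exp c * I 0 h" using shift[OF g1, of 0 h] by (simp add: add.commute)
  ultimately have "I 0 1 * (1 + exp (c * of_real h)) = I 0 h * (1 - exp c)" by (simp add: algebra_simps)
  moreover have "I 0 1 = (LBINT x:{0..1}. g x)" unfolding I_def by (rule set_integral_Ico_Icc) (simp add: g_def)
  moreover have "c * of_real h = c / of_real (2 * M)" by (simp add: h_def)
  ultimately show ?thesis unfolding I_def g_def h_def by simp
qed

section \<open>Integrals against the square wave\<close>

lemma square_wave_values:
  assumes "M > 0"
  shows "0 \<le> x \<Longrightarrow> x < 1 / (4 * M) \<Longrightarrow> square_wave M x = 1" "1 / (4 * M) < x \<Longrightarrow> x < 1 / (2 * M) \<Longrightarrow> square_wave M x = -1"
proof -
  assume x: "0 \<le> x" "x < 1 / (4 * M)"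
  hence "4 * M * x < 1" using assms by (simp add: field_simps)
  hence "pi * (4 * M * x) < pi * 1" by (intro mult_strict_left_mono) auto
  hence "2 * pi * M * x < pi / 2" by simp
  moreover have "0 \<le> 2 * pi * M * x" using x assms by simp
  ultimately have "cos (2 * pi * M * x) > 0" by (intro cos_gt_zero_pi) (use pi_gt_zero in linarith)+
  thus "square_wave M x = 1" by (simp add: square_wave_def)
next
  assume x: "1 / (4 * M) < x" "x < 1 / (2 * M)"
  hence "1 < 4 * M * x" "2 * M * x < 1" using assms by (simp_all add: field_simps)
  hence "pi * 1 < pi * (4 * M * x)" "pi * (2 * M * x) < pi * 1" by (intro mult_strict_left_mono; auto)+
  moreover have "pi * (4 * M * x) = 2 * (2 * pi * M * x)" "pi * (2 * M * x) = 2 * pi * M * x" by simp_all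
  ultimately have "- (pi / 2) < 2 * pi * M * x - pi" "2 * pi * M * x - pi < pi / 2"
    using pi_gt_zero by linarith+
  hence "cos (2 * pi * M * x - pi) > 0" by (rule cos_gt_zero_pi)
  thus "square_wave M x = -1" by (simp add: square_wave_def cos_diff)
qed

text \<open>The wave is 1 on the first quarter wavelength and -1 on the second. With E = exp(c / (4
  M)) this gives (E - 1) / c - (E^2 - E) / c.\<close>

lemma square_wave_exp_cell:
  assumes "M > 0" "c \<noteq> 0"
  shows "(LINT x|lborel. indicator {0..<1 / (2 * M)} x *\<^sub>R (exp (c * complex_of_real x) * of_real (square_wave M x))) =
    - (1 - exp (c / of_real (4 * M)))\<^sup>2 / c"
proof -
  define a where "a = 1 / (4 * M)"
  have a: "0 < a" "1 / (2 * M) = 2 * a" using assms by (auto simp: a_def)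
  have "has_bochner_integral lborel (\<lambda>x. indicator {0..a} x *\<^sub>R exp (c * of_real x) - indicator {a..2*a} x *\<^sub>R exp (c * of_real x))
     ((exp (c * of_real a) - exp (c * of_real 0)) / c - (exp (c * of_real (2 * a)) - exp (c * of_real a)) / c)"
    using a by (intro has_bochner_integral_diff exp_integral assms) auto
  hence "(LINT x|lborel. indicator {0..a} x *\<^sub>R exp (c * of_real x) - indicator {a..2*a} x *\<^sub>R exp (c * of_real x)) =
     (exp (c * of_real a) - exp (c * of_real 0)) / c - (exp (c * of_real (2 * a)) - exp (c * of_real a)) / c"
    by (rule has_bochner_integral_integral_eq)
  moreover have "(LINT x|lborel. indicator {0..<1 / (2 * M)} x *\<^sub>R (exp (c * complex_of_real x) * of_real (square_wave M x))) =
    (LINT x|lborel. indicator {0..a} x *\<^sub>R exp (c * of_real x) - indicator {a..2*a} x *\<^sub>R exp (c * of_real x))"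
  proof (rule integral_cong_AE)
    show "AE x in lborel. indicator {0..<1 / (2 * M)} x *\<^sub>R (exp (c * complex_of_real x) * of_real (square_wave M x)) =
      indicator {0..a} x *\<^sub>R exp (c * of_real x) - indicator {a..2*a} x *\<^sub>R exp (c * of_real x)"
      using AE_lborel_singleton[of a] AE_lborel_singleton[of "2 * a"]
      by eventually_elim (use square_wave_values[OF assms(1)] a in \<open>auto simp: indicator_def a_def[symmetric]\<close>)
  qed measurable
  moreover have "exp (c * of_real (2 * a)) = (exp (c * of_real a))\<^sup>2" by (simp add: exp_double[symmetric] mult_ac)
  moreover have "c * of_real a = c / of_real (4 * M)" by (simp add: a_def)
  moreover have "(E - exp (c * of_real 0)) / c - (E\<^sup>2 - E) / c = - (1 - E)\<^sup>2 / c" for E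
  proof -
    have "E - exp (c * of_real 0) - (E\<^sup>2 - E) = - (1 - E)\<^sup>2" by (simp add: power2_eq_square algebra_simps)
    thus ?thesis by (simp only: diff_divide_distrib[symmetric])
  qed
  ultimately show ?thesis by (simp only:)
qed

text \<open>For an integer frequency exp c = 1, so the right side of
  \<open>square_wave_exp_integral\<close> vanishes. Since |n| <= N < M, the angle pi n / M lies
  strictly between -pi and pi, and the factor 1 + exp(c / (2 M)) is not 0.\<close>

lemma e_orthogonal_square_wave:
  assumes M: "M = real (Suc N)" and n: "n \<in> {- int N..int N}"
  shows "(LBINT x:{0..1}. e (of_int n * x) * of_real (square_wave M x)) = 0"
proof -
  define c where "c = of_real (2 * pi * of_int n) * \<i>"
  have ec: "e (of_int n * x) = exp (c * of_real x)" for x unfolding c_def by (rule e_exp)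
  have "exp c = 1" using ec[of 1] e_int[of n] by simp
  moreover have "1 + exp (c / of_real (2 * M)) \<noteq> 0"
  proof
    assume "1 + exp (c / of_real (2 * M)) = 0"
    moreover have "c / of_real (2 * M) = \<i> * of_real (pi * (of_int n / M))" 
    proof -
      have "c / of_real (2 * M) = \<i> * of_real (2 * pi * of_int n / (2 * M))"
        unfolding c_def of_real_divide by simp
      also have "2 * pi * of_int n / (2 * M) = pi * (of_int n / M)" by simp
      finally show ?thesis .
    qed
    ultimately have "1 + Re (cis (pi * (of_int n / M))) = 0" by (simp add: cis_conv_exp flip: plus_complex.sel one_complex.sel)
    hence "cos (pi * (of_int n / M)) = - 1" by simp
    moreover have "cos (pi * \<bar>u\<bar>) = cos (pi * u)" for u by (cases "u \<ge> 0") auto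
    ultimately have "cos (pi * \<bar>of_int n / M\<bar>) = - 1" by (simp only:)
    moreover have "\<bar>of_int n / M\<bar> < 1" using M n by (auto simp: abs_less_iff field_simps)
    hence "pi * \<bar>of_int n / M\<bar> < pi * 1" by (intro mult_strict_left_mono) auto
    hence "cos pi < cos (pi * \<bar>of_int n / M\<bar>)" by (intro cos_monotone_0_pi) auto
    ultimately show False by simp
  qed
  ultimately show ?thesis using square_wave_exp_integral[OF M, of c] unfolding ec by simp
qed

lemma has_bochner_integral_exp_square_wave:
  "has_bochner_integral lborel (\<lambda>x. indicator {0..1} x *\<^sub>R (exp (c * complex_of_real x) * of_real (square_wave M x)))
     (LBINT x:{0..1}. exp (c * complex_of_real x) * of_real (square_wave M x))"
  unfolding set_lebesgue_integral_def has_bochner_integral_iff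
proof
  show "integrable lborel (\<lambda>x. indicator {0..1} x *\<^sub>R (exp (c * complex_of_real x) * of_real (square_wave M x)))"
  proof (rule Bochner_Integration.integrable_bound[OF square_wave_exp_integrable[of 0 2 c M]])
  qed (auto simp: indicator_def)
qed simp

lemma trig_poly_orthogonal_square_wave:
  assumes M: "M = real (Suc N)" and kt: "trig_poly N kt"
  shows "has_bochner_integral lborel (\<lambda>x. indicator {0..1} x *\<^sub>R (kt x * of_real (square_wave M x))) 0"
proof -
  obtain c where c: "\<And>x. kt x = (\<Sum>n = - int N..int N. c n * e (of_int n * x))" using kt by (auto simp: trig_poly_def)
  have "has_bochner_integral lborel (\<lambda>x. \<Sum>n = - int N..int N. c n * (indicator {0..1} x *\<^sub>R (e (of_int n * x) * of_real (square_wave M x)))) (\<Sum>n = - int N..int N. c n * 0)"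
  proof (intro has_bochner_integral_sum has_bochner_integral_mult_right)
    fix n assume "n \<in> {- int N..int N}"
    from e_orthogonal_square_wave[OF M this]
    show "has_bochner_integral lborel (\<lambda>x. indicator {0..1} x *\<^sub>R (e (of_int n * x) * of_real (square_wave M x))) 0"
      using has_bochner_integral_exp_square_wave[of "of_real (2 * pi * of_int n) * \<i>" M] unfolding e_exp by simp
  qed
  thus ?thesis by (simp add: c sum_distrib_left sum_distrib_right scaleR_sum_right mult_ac)
qed

text \<open>On [0, 1] the integrand combines 1, exp(-lam x) and exp(lam x). The constant contributes
  0 and each exponential (1 - q)^2 / (lam (1 + q^2)), where q = exp(lam / (4 M)); finally (1 - q)^2
  / (1 + q^2) = 1 - sech(lam / (4 M)).\<close>

lemma p_square_wave_integral:
  assumes lam: "lam > 0" and M: "M = real (Suc N)"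
  shows "has_bochner_integral lborel (\<lambda>x. indicator {0..1} x *\<^sub>R (complex_of_real (- 2 / lam + exp_periodization lam x) * of_real (square_wave M x)))
    (of_real (2 / lam - 2 / lam * sech (lam / (4 * M))))"
proof -
  have Mp: "M > 0" by (simp add: M)
  define A where "A c = (LBINT x:{0..1}. exp (c * complex_of_real x) * of_real (square_wave M x))" for c
  have A0: "A 0 = 0" using square_wave_exp_integral[OF M, of 0] by (simp add: A_def)
  define E where "E t = exp (t / (4 * M))" for t
  have Ac: "A (of_real t) = of_real (- (1 - E t)\<^sup>2 / t * (1 - exp t) / (1 + (E t)\<^sup>2))" if "t \<noteq> 0" for t :: real
  proof -
    have e1: "exp (complex_of_real t / of_real (4 * M)) = of_real (E t)" unfolding E_def by (simp flip: exp_of_real)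
    have e2: "exp (complex_of_real t / of_real (2 * M)) = of_real ((E t)\<^sup>2)"
      using Mp unfolding E_def by (simp flip: exp_of_real add: exp_double[symmetric])
    have nz: "1 + (E t)\<^sup>2 > 0" by (simp add: add_pos_nonneg)
    hence nz': "complex_of_real (1 + (E t)\<^sup>2) \<noteq> 0" unfolding of_real_eq_0_iff by simp
    have "A (of_real t) * of_real (1 + (E t)\<^sup>2) = of_real (- (1 - E t)\<^sup>2 / t * (1 - exp t))"
      using square_wave_exp_integral[OF M, of "of_real t"] square_wave_exp_cell[OF Mp, of "of_real t"] that
      unfolding A_def[symmetric] e1 e2 by (simp add: exp_of_real)
    hence "A (of_real t) = of_real (- (1 - E t)\<^sup>2 / t * (1 - exp t)) / of_real (1 + (E t)\<^sup>2)"
      unfolding nonzero_eq_divide_eq[OF nz'] .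
    thus ?thesis by (simp only: of_real_divide)
  qed
  define d where "d = 1 - exp (- lam)"
  have d: "d > 0" using lam by (simp add: d_def)
  have "has_bochner_integral lborel (\<lambda>x. of_real (- 2 / lam) * (indicator {0..1} x *\<^sub>R (exp (0 * complex_of_real x) * of_real (square_wave M x)))
    + of_real (1 / d) * (indicator {0..1} x *\<^sub>R (exp (of_real (- lam) * complex_of_real x) * of_real (square_wave M x)))
    + of_real (exp (- lam) / d) * (indicator {0..1} x *\<^sub>R (exp (of_real lam * complex_of_real x) * of_real (square_wave M x))))
    (of_real (- 2 / lam) * A 0 + of_real (1 / d) * A (of_real (- lam)) + of_real (exp (- lam) / d) * A (of_real lam))"
    unfolding A_def by (intro has_bochner_integral_add has_bochner_integral_mult_right has_bochner_integral_exp_square_wave)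
  also have "(\<lambda>x. of_real (- 2 / lam) * (indicator {0..1} x *\<^sub>R (exp (0 * complex_of_real x) * of_real (square_wave M x)))
    + of_real (1 / d) * (indicator {0..1} x *\<^sub>R (exp (of_real (- lam) * complex_of_real x) * of_real (square_wave M x)))
    + of_real (exp (- lam) / d) * (indicator {0..1} x *\<^sub>R (exp (of_real lam * complex_of_real x) * of_real (square_wave M x)))) =
    (\<lambda>x. indicator {0..1} x *\<^sub>R (complex_of_real (- 2 / lam + exp_periodization lam x) * of_real (square_wave M x)))"
  proof
    fix x
    have "exp_periodization lam x = 1 / d * exp (- lam * x) + exp (- lam) / d * exp (lam * x)"
    proof -
      have "exp (- lam * (1 - x)) = exp (- lam) * exp (lam * x)" by (simp add: exp_add[symmetric] algebra_simps)
      thus ?thesis by (simp add: exp_periodization_def d_def add_divide_distrib)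
    qed
    moreover have "exp (of_real t * complex_of_real x) = of_real (exp (t * x))" for t by (simp flip: exp_of_real)
    ultimately show "of_real (- 2 / lam) * (indicator {0..1} x *\<^sub>R (exp (0 * complex_of_real x) * of_real (square_wave M x)))
    + of_real (1 / d) * (indicator {0..1} x *\<^sub>R (exp (of_real (- lam) * complex_of_real x) * of_real (square_wave M x)))
    + of_real (exp (- lam) / d) * (indicator {0..1} x *\<^sub>R (exp (of_real lam * complex_of_real x) * of_real (square_wave M x)))
     = indicator {0..1} x *\<^sub>R (complex_of_real (- 2 / lam + exp_periodization lam x) * of_real (square_wave M x))"
      by (simp only: scaleR_conv_of_real mult_zero_left exp_zero) (simp add: algebra_simps)
  qed
  also have "of_real (- 2 / lam) * A 0 + of_real (1 / d) * A (of_real (- lam)) + of_real (exp (- lam) / d) * A (of_real lam) =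
     of_real (2 / lam - 2 / lam * sech (lam / (4 * M)))"
  proof -
    define q where "q = E lam"
    have q: "q > 0" "E (- lam) = 1 / q" by (auto simp: q_def E_def exp_minus inverse_eq_divide)
    have q2: "1 + q\<^sup>2 > 0" by (simp add: add_pos_nonneg)
    have el: "exp (- lam) * (1 - exp lam) = - d" by (simp add: d_def right_diff_distrib flip: exp_add)
    \<comment> \<open>Invariance under q -> 1 / q is why the exponents \<open>- lam\<close> and
      \<open>lam\<close> contribute equally.\<close>
    have r1: "(1 - 1 / q)\<^sup>2 / (1 + (1 / q)\<^sup>2) = (1 - q)\<^sup>2 / (1 + q\<^sup>2)"
    proof -
      have "(1 - 1 / q)\<^sup>2 = (1 - q)\<^sup>2 / q\<^sup>2" "1 + (1 / q)\<^sup>2 = (1 + q\<^sup>2) / q\<^sup>2"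
        using q by (simp_all add: field_simps power2_eq_square)
      thus ?thesis using q by simp
    qed
    have "1 / d * (- (1 - 1 / q)\<^sup>2 / (- lam) * (1 - exp (- lam)) / (1 + (1 / q)\<^sup>2)) = (1 - q)\<^sup>2 / (1 + q\<^sup>2) / lam"
      unfolding r1[symmetric] using d by (simp add: d_def[symmetric])
    moreover have "exp (- lam) / d * (- (1 - q)\<^sup>2 / lam * (1 - exp lam) / (1 + q\<^sup>2)) = (1 - q)\<^sup>2 / (1 + q\<^sup>2) / lam"
    proof -
      have "exp (- lam) / d * (- (1 - q)\<^sup>2 / lam * (1 - exp lam) / (1 + q\<^sup>2)) =
         (exp (- lam) * (1 - exp lam)) * (- (1 - q)\<^sup>2 / lam / (1 + q\<^sup>2)) / d" by (simp add: mult_ac)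
      thus ?thesis unfolding el using d by simp
    qed
    moreover have "(1 - q)\<^sup>2 / (1 + q\<^sup>2) / lam + (1 - q)\<^sup>2 / (1 + q\<^sup>2) / lam = 2 / lam - 2 / lam * sech (lam / (4 * M))"
    proof -
      have "cosh (lam / (4 * M)) = (q + 1 / q) / 2" using q by (simp add: cosh_def q_def E_def exp_minus inverse_eq_divide)
      hence "sech (lam / (4 * M)) = 2 * q / (1 + q\<^sup>2)" using q q2 by (simp add: sech_def field_simps power2_eq_square)
      thus ?thesis using lam q2 by (simp add: divide_simps) (simp add: power2_eq_square algebra_simps)
    qed
    ultimately have "1 / d * (- (1 - 1 / q)\<^sup>2 / (- lam) * (1 - exp (- lam)) / (1 + (1 / q)\<^sup>2)) +
        exp (- lam) / d * (- (1 - q)\<^sup>2 / lam * (1 - exp lam) / (1 + q\<^sup>2)) = 2 / lam - 2 / lam * sech (lam / (4 * M))"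
      by simp
    thus ?thesis unfolding A0 using lam q by (simp only: Ac q q_def[symmetric] of_real_mult[symmetric] of_real_add[symmetric] mult_zero_right add_0_left neg_equal_0_iff_equal less_imp_neq[symmetric] not_False_eq_True) 
  qed
  finally show ?thesis .
qed

section \<open>Zeros of trigonometric polynomials\<close>

lemma e_inj:
  assumes "e x = e y" "0 \<le> x" "x < 1" "0 \<le> y" "y < 1"
  shows "x = y"
proof -
  have "e (x - y) * e y = e y" using assms(1) e_add[of "x - y" y] by simp
  moreover have "e y \<noteq> 0" by (metis norm_e norm_zero zero_neq_one)
  ultimately have "exp (complex_of_real (2 * pi * (x - y)) * \<i>) = 1" by (simp add: e_def)
  then obtain n :: int where "2 * pi * (x - y) = of_int (2 * n) * pi" by (auto simp: exp_eq_1)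
  hence "x - y = of_int n" by simp
  moreover have "\<bar>x - y\<bar> < 1" using assms by simp
  ultimately have "n = 0" by simp
  thus ?thesis using \<open>x - y = of_int n\<close> by simp
qed

text \<open>e(N x) q(x) is an algebraic polynomial in e(x) of degree at most 2 N. As
  \<open>e\<close> is injective on [0, 1), more than 2 N zeros of q give it too many roots unless it
  is 0.\<close>

lemma trig_poly_eq_0:
  assumes q: "trig_poly N q" and S: "finite S" "S \<subseteq> {0..<1}" "card S > 2 * N" "\<And>x. x \<in> S \<Longrightarrow> q x = 0"
  shows "q x = 0"
proof -
  obtain c where c: "\<And>x. q x = (\<Sum>n = - int N..int N. c n * e (of_int n * x))" using q by (auto simp: trig_poly_def)
  define P where "P = (\<Sum>i\<le>2 * N. monom (c (int i - int N)) i)"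
  have P: "poly P (e x) = e (of_int (int N) * x) * q x" for x
  proof -
    have "poly P (e x) = (\<Sum>i\<le>2 * N. c (int i - int N) * e x ^ i)" by (simp add: P_def poly_sum poly_monom)
    also have "\<dots> = (\<Sum>n = - int N..int N. c n * e x ^ nat (n + int N))"
      by (rule sum.reindex_bij_witness[of _ "\<lambda>n. nat (n + int N)" "\<lambda>i. int i - int N"]) auto
    also have "\<dots> = (\<Sum>n = - int N..int N. e (of_int (int N) * x) * (c n * e (of_int n * x)))"
    proof (rule sum.cong[OF refl])
      fix n assume "n \<in> {- int N..int N}"
      have pw: "e x ^ k = e (real k * x)" for k 
        unfolding e_cis Complex.DeMoivre by (rule arg_cong[where f = cis]) simp
      have "real (nat (n + int N)) = of_int n + of_int (int N)" using \<open>n \<in> _\<close> by simp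
      thus "c n * e x ^ nat (n + int N) = e (of_int (int N) * x) * (c n * e (of_int n * x))"
        unfolding pw by (simp add: distrib_right e_add)
    qed
    finally show ?thesis by (simp add: c sum_distrib_left)
  qed
  have "P = 0"
  proof (rule ccontr)
    assume nz: "P \<noteq> 0"
    have "e ` S \<subseteq> {z. poly P z = 0}" using P S(4) by auto
    hence "card (e ` S) \<le> card {z. poly P z = 0}" by (intro card_mono poly_roots_finite nz)
    also have "\<dots> \<le> degree P" by (rule card_poly_roots_bound[OF nz])
    also have "\<dots> \<le> 2 * N" unfolding P_def by (intro degree_sum_le order_trans[OF degree_monom_le]) auto
    also have "card (e ` S) = card S" using S(2) by (intro card_image inj_onI e_inj) auto
    finally show False using S(3) by simp
  qed
  hence "e (of_int (int N) * x) * q x = 0" using P[of x] by simp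
  moreover have "e (of_int (int N) * x) \<noteq> 0" by (metis norm_e norm_zero zero_neq_one)
  ultimately show ?thesis by simp
qed

lemma trig_poly_diff: "trig_poly N f \<Longrightarrow> trig_poly N g \<Longrightarrow> trig_poly N (\<lambda>x. f x - g x)"
proof -
  assume "trig_poly N f" "trig_poly N g"
  then obtain c d where "\<And>x. f x = (\<Sum>n = - int N..int N. c n * e (of_int n * x))" "\<And>x. g x = (\<Sum>n = - int N..int N. d n * e (of_int n * x))"
    by (auto simp: trig_poly_def)
  thus ?thesis unfolding trig_poly_def
    by (intro exI[of _ "\<lambda>n. c n - d n"]) (simp add: left_diff_distrib sum_subtractf)
qed

text \<open>The summand -2 / lam is absorbed into the coefficient of frequency 0.\<close>

lemma trig_poly_k_fun:
  assumes "lam > 0" shows "trig_poly N (k_fun lam N)"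
proof -
  define d where "d = interp_coeff N (lam / (2 * real N + 2))"
  have "k_fun lam N x = complex_of_real (cos_poly N (d (0 := - 2 / lam + d 0)) x)" for x
    unfolding k_fun_eq[OF assms] d_def[symmetric] by (simp add: cos_poly_def)
  thus ?thesis unfolding trig_poly_def cos_poly_eq
    by (intro exI[of _ "\<lambda>n. complex_of_real ((d (0 := - 2 / lam + d 0)) (nat \<bar>n\<bar>))"]) simp
qed

lemma trig_poly_continuous: "trig_poly N f \<Longrightarrow> continuous_on A f"
proof -
  assume "trig_poly N f"
  then obtain c where "\<And>x. f x = (\<Sum>n = - int N..int N. c n * e (of_int n * x))" by (auto simp: trig_poly_def)
  hence "f = (\<lambda>x. \<Sum>n = - int N..int N. c n * e (of_int n * x))" by auto
  thus ?thesis by (simp only:) (intro continuous_intros)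
qed

theorem theorem6p1:
  fixes lam :: real and N :: nat
  assumes "lam > 0"
  shows "(\<forall>kt. trig_poly N kt \<longrightarrow>
            (LBINT x:{0..1}. cmod (complex_of_real (p_fun lam x) - kt x))
               \<ge> 2 / lam - 2 / lam * sech (lam / (4 * real N + 4))
          \<and> ((LBINT x:{0..1}. cmod (complex_of_real (p_fun lam x) - kt x))
               = 2 / lam - 2 / lam * sech (lam / (4 * real N + 4))
             \<longleftrightarrow> (\<forall>x. kt x = k_fun lam N x)))
      \<and> (\<forall>x::real. sgn (complex_of_real (cos (pi * (2 * real N + 2) * x)))
                   = sgn (complex_of_real (p_fun lam x) - k_fun lam N x))"
proof (intro conjI allI impI)
  fix x show "sgn (complex_of_real (cos (pi * (2 * real N + 2) * x))) = sgn (complex_of_real (p_fun lam x) - k_fun lam N x)"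
    by (rule sgn_error[OF assms])
next
  fix kt assume kt: "trig_poly N kt"
  define M where "M = real (Suc N)"
  have Mp: "M > 0" by (simp add: M_def)
  have M4: "4 * real N + 4 = 4 * M" and M2: "2 * real N + 2 = 2 * M" by (simp_all add: M_def)
  define V where "V = 2 / lam - 2 / lam * sech (lam / (4 * M))"
  define f where "f x = complex_of_real (- 2 / lam + exp_periodization lam x) - kt x" for x
  define I where "I = (LBINT x:{0..1}. cmod (complex_of_real (p_fun lam x) - kt x))"
  have I: "I = (LINT x|lborel. indicator {0..1} x *\<^sub>R cmod (f x))"
    unfolding I_def set_lebesgue_integral_def
    by (intro Bochner_Integration.integral_cong) (auto simp: indicator_def f_def p_fun_eq[OF assms])
  have cf: "continuous_on A f" for A unfolding f_def
    by (intro continuous_intros continuous_on_exp_periodization assms trig_poly_continuous[OF kt])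
  have i1: "integrable lborel (\<lambda>x. indicator {0..1} x *\<^sub>R cmod (f x))"
    by (intro borel_integrable_compact continuous_on_norm cf) auto
  \<comment> \<open>Orthogonality removes \<open>kt\<close>: the error integrated against the square
    wave gives \<open>V\<close> for every admissible \<open>kt\<close>.\<close>
  have "has_bochner_integral lborel (\<lambda>x. indicator {0..1} x *\<^sub>R (complex_of_real (- 2 / lam + exp_periodization lam x) * of_real (square_wave M x)) -
       indicator {0..1} x *\<^sub>R (kt x * of_real (square_wave M x))) (of_real V - 0)"
    unfolding V_def by (intro has_bochner_integral_diff p_square_wave_integral[OF assms M_def] trig_poly_orthogonal_square_wave[OF M_def kt])
  hence "has_bochner_integral lborel (\<lambda>x. indicator {0..1} x *\<^sub>R (f x * of_real (square_wave M x))) (of_real V)"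
    by (simp add: f_def left_diff_distrib scaleR_diff_right)
  hence "has_bochner_integral lborel (\<lambda>x. Re (indicator {0..1} x *\<^sub>R (f x * of_real (square_wave M x)))) (Re (of_real V))"
    by (rule has_bochner_integral_Re)
  hence b: "has_bochner_integral lborel (\<lambda>x. indicator {0..1} x *\<^sub>R (Re (f x) * square_wave M x)) V" by simp
  \<comment> \<open>The loss in passing from |f| to Re(f) times the wave. It is nonnegative with
    integral \<open>I - V\<close>, which yields both the bound and its equality case.\<close>
  define D where "D x = indicator {0..1} x *\<^sub>R (cmod (f x) - Re (f x) * square_wave M x)" for x
  have "has_bochner_integral lborel (\<lambda>x. indicator {0..1} x *\<^sub>R cmod (f x) - indicator {0..1} x *\<^sub>R (Re (f x) * square_wave M x)) (I - V)"
    unfolding I by (intro has_bochner_integral_diff b has_bochner_integral_integrable i1)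
  hence D: "has_bochner_integral lborel D (I - V)" by (simp add: D_def[abs_def] right_diff_distrib)
  have le: "Re (f x) * square_wave M x \<le> cmod (f x)" for x
  proof -
    have "Re (f x) * square_wave M x \<le> \<bar>Re (f x)\<bar> * \<bar>square_wave M x\<bar>" by (simp flip: abs_mult)
    also have "\<dots> \<le> cmod (f x) * 1" by (intro mult_mono abs_Re_le_cmod square_wave_bound) auto
    finally show ?thesis by simp
  qed
  have D0: "D x \<ge> 0" for x using le[of x] by (simp add: D_def indicator_def)
  have IV: "I - V = (LINT x|lborel. D x)" using D by (simp add: has_bochner_integral_iff)
  have iff: "I = V \<longleftrightarrow> (AE x in lborel. D x = 0)"
    using integral_nonneg_eq_0_iff_AE[of lborel D] D D0 IV by (auto simp: has_bochner_integral_iff)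
  have "I - V \<ge> 0" unfolding IV using D0 by (intro integral_nonneg_AE) auto
  thus "(LBINT x:{0..1}. cmod (complex_of_real (p_fun lam x) - kt x)) \<ge> 2 / lam - 2 / lam * sech (lam / (4 * real N + 4))"
    unfolding M4 I_def[symmetric] V_def by simp
  have k: "k_fun lam N x = complex_of_real (- 2 / lam + cos_poly N (interp_coeff N (lam / (2 * M))) x)" for x
    by (simp only: k_fun_eq[OF assms] M2)
  have "I = V \<longleftrightarrow> (\<forall>x. kt x = k_fun lam N x)"
  proof
    assume "\<forall>x. kt x = k_fun lam N x"
    hence fx: "f x = of_real (exp_periodization lam x - cos_poly N (interp_coeff N (lam / (2 * M))) x)" for x by (simp add: f_def k)
    \<comment> \<open>The error of \<open>k_fun\<close> has the sign of the wave off the zeros of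
      the cosine, so there is no loss. The point 1 is set aside because
      \<open>error_square_wave\<close> covers [0, 1).\<close>
    have "AE x in lborel. D x = 0"
      using AE_cos_nonzero[OF Mp] AE_lborel_singleton[of 1]
    proof eventually_elim
      case (elim x)
      show ?case
      proof (cases "x \<in> {0..1}")
        case True
        hence "0 \<le> x" "x < 1" using elim by auto
        define d where "d = exp_periodization lam x - cos_poly N (interp_coeff N (lam / (2 * M))) x"
        have d: "\<bar>d\<bar> * square_wave M x = d"
          unfolding d_def by (rule error_square_wave(1)[OF assms M_def elim(1) \<open>0 \<le> x\<close> \<open>x < 1\<close>, symmetric])
        have "square_wave M x * square_wave M x = 1" using elim(1) by (simp add: square_wave_def sgn_real_def)
        hence "\<bar>d\<bar> = \<bar>d\<bar> * square_wave M x * square_wave M x" by (simp only: mult.assoc mult_1_right)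
        also have "\<dots> = d * square_wave M x" by (simp only: d)
        finally show ?thesis unfolding D_def fx d_def[symmetric] by simp
      qed (simp add: D_def)
    qed
    thus "I = V" using iff by simp
  next
    assume "I = V"
    hence ae: "AE x in lborel. D x = 0" using iff by simp
    have "AE x in lborel. x \<in> {0..1} \<longrightarrow> f x = of_real (cmod (f x) * square_wave M x)"
      using ae AE_cos_nonzero[OF Mp]
    proof (eventually_elim, intro impI)
      fix x assume x: "D x = 0" "cos (2 * pi * M * x) \<noteq> 0" "x \<in> {0..1}"
      hence eq: "cmod (f x) = Re (f x) * square_wave M x" by (simp add: D_def)
      have s: "square_wave M x = 1 \<or> square_wave M x = -1" using x(2) by (auto simp: square_wave_def sgn_real_def)
      \<comment> \<open>The wave is 1 or -1 here, so equality forces |f| = |Re f|; hence f is real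
        and carries the sign of the wave.\<close>
      hence "cmod (f x) = \<bar>Re (f x)\<bar>" using eq norm_ge_zero[of "f x"] by auto
      hence "Im (f x) = 0" using cmod_power2[of "f x"] by simp
      thus "f x = of_real (cmod (f x) * square_wave M x)" using eq s by (auto simp: complex_eq_iff)
    qed
    note dense = AE_imp_dense[OF this]
    \<comment> \<open>The zeros of cos(2 pi M x) in (0, 1), obtained from 2 M x = half r with r < 2
      N + 2.\<close>
    define node where "node r = (2 * real r + 1) / (4 * M)" for r :: nat
    have node: "0 < node r" "node r < 1" "cos (2 * pi * M * node r) = 0" if "r < 2 * N + 2" for r
    proof -
      show "0 < node r" using Mp by (simp add: node_def add_nonneg_pos)
      have "real r + 1 \<le> 2 * real N + 2" using that by linarith
      thus "node r < 1" using Mp by (simp add: node_def M_def)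
      have "2 * pi * M * node r = pi * half r" using Mp by (simp add: node_def half_def field_simps)
      thus "cos (2 * pi * M * node r) = 0" by (simp only: cos_half_eq_0)
    qed
    have zero: "kt (node r) - k_fun lam N (node r) = 0" if "r < 2 * N + 2" for r
    proof -
      \<comment> \<open>Both polynomials interpolate p at the nodes: \<open>kt\<close> by the sign
        change of its error, \<open>k_fun\<close> by \<open>error_node\<close>.\<close>
      have "f (node r) = 0" by (rule sign_change_zero[OF Mp cf node[OF that] dense])
      moreover have "exp_periodization lam (node r) = cos_poly N (interp_coeff N (lam / (2 * M))) (node r)"
        by (rule error_node[OF assms M_def node(3)[OF that] less_imp_le[OF node(1)[OF that]] node(2)[OF that]])
      ultimately show ?thesis unfolding f_def k by simp
    qed
    have inj: "inj_on node {..<2 * N + 2}"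
    proof (rule inj_onI)
      fix r s :: nat assume "node r = node s"
      thus "r = s" using Mp by (simp add: node_def)
    qed
    \<comment> \<open>The difference has degree at most N but vanishes at 2 N + 2 > 2 N points of
      [0, 1).\<close>
    have "kt x - k_fun lam N x = 0" for x
    proof (rule trig_poly_eq_0[OF trig_poly_diff[OF kt trig_poly_k_fun[OF assms]]])
      show "finite (node ` {..<2 * N + 2})" by simp
      show "node ` {..<2 * N + 2} \<subseteq> {0..<1}" using node(1,2) by (force simp: less_imp_le)
      show "card (node ` {..<2 * N + 2}) > 2 * N" unfolding card_image[OF inj] by simp
      show "kt y - k_fun lam N y = 0" if "y \<in> node ` {..<2 * N + 2}" for y
        using that zero by (elim imageE) (simp only: lessThan_iff)
    qed
    thus "\<forall>x. kt x = k_fun lam N x" by simp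
  qed
  thus "((LBINT x:{0..1}. cmod (complex_of_real (p_fun lam x) - kt x)) = 2 / lam - 2 / lam * sech (lam / (4 * real N + 4)))
             \<longleftrightarrow> (\<forall>x. kt x = k_fun lam N x)"
    unfolding M4 I_def[symmetric] V_def .
qed

end
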